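(* Let $d\ge 1$. Let $\mathbf{r}=(r_1,\ldots,r_d)\colon \mathbb{N}\to (0,\frac12)^d$ be doubling, and let $\mu$ be a probability measure on $[0,1)^d$. Let $\mathcal{A}=(A_n)_{n\in\mathbb{N}}$ be a sequence of integral $d\times d$ matrices. Assume that, for some $c,s,\varepsilon>0$, we have $$\sigma(A_n-A_m)\ge c\,|n-m|^{\frac1s}\,(\log_+|n-m|)^{\frac1s+\varepsilon}$$ for all $m,n\in\mathbb{N}$ with $m\ne n$. Assume also that $$\widehat{\mu}(\mathbf{t})=O(|\mathbf{t}|_\infty^{-s})\quad\text{as } |\mathbf{t}|_\infty\to\infty .$$ Then, for $\mu$-almost all $\boldsymbol{\alpha}\in[0,1)^d$, $$\mathcal{L}^d\big(\mathcal{T}_{\boldsymbol{\alpha}}(\mathcal{A},\mathbf{r})\big)=\begin{cases}0, & \text{if } \sum_{n=1}^\infty\prod_{i=1}^d r_i(n)<\infty,\\ 1, & \text{if } \sum_{n=1}^\infty\prod_{i=1}^d r_i(n)=\infty.\end{cases}$$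
   Context: $\mathbb{N}=\{1,2,\ldots\}$. $\mathcal{L}^d$ is $d$-dimensional Lebesgue measure. $\|x\|$ denotes the distance from a real number $x$ to the nearest integer, and $|\mathbf{t}|_\infty=\max_i|t_i|$. $\log_+ m=\max\{1,\log m\}$. A $d$-tuple $\mathbf{r}=(r_1,\dots,r_d)$ of non-increasing functions $r_i\colon\mathbb{N}\to(0,\frac12)$ is called doubling if there exists $C>1$ such that $r_i(n)\le C\,r_i(2n)$ for all $1\le i\le d$ and all $n\in\mathbb{N}$ (so doubling includes monotonicity). For a $d\times d$ matrix $A$, $\sigma(A)=\inf\{\|Ax\|_2:\|x\|_2=1\}$ is its smallest singular value. The Fourier transform of a probability measure $\mu$ is $\widehat\mu(\mathbf{t})=\int e^{-2\pi i\langle \mathbf{t},\mathbf{x}\rangle}\,d\mu(\mathbf{x})$ for $\mathbf{t}\in\mathbb{R}^d$, where $\langle\mathbf{t},\mathbf{x}\rangle=t_1x_1+\cdots+t_dx_d$. $\mathcal{R}_n(\mathbf{r})=\{\mathbf{x}\in[0,1)^d:\|x_i\|\le r_i(n),\ 1\le i\le d\}$, and $$\mathcal{T}_{\boldsymbol\alpha}(\mathcal{A},\mathbf{r})=\{\boldsymbol\beta\in[0,1)^d: A_n\boldsymbol\alpha\in\boldsymbol\beta+\mathcal{R}_n(\mathbf{r})\ (\mathrm{mod}\ 1)\text{ for infinitely many } n\in\mathbb{N}\},$$ i.e. $\boldsymbol\beta$ belongs to this set iff for infinitely many $n$ one has $\|(A_n\boldsymbol\alpha)_i-\beta_i\|\le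 r_i(n)$ for all $1\le i\le d$. *)

theory Defs
  imports "HOL-Probability.Probability" "HOL-Library.Landau_Symbols"
begin

(* Sequences indexed by {1, 2, ...} are functions on nat whose value at 0 is never constrained or used. *)

definition dist_int :: "real \<Rightarrow> real"
  where "dist_int x = infdist x \<int>"

definition log_plus :: "real \<Rightarrow> real"
  where "log_plus x = max 1 (ln x)"

definition unit_cube :: "(real ^ 'd) set"
  where "unit_cube = {x. \<forall>i. 0 \<le> x $ i \<and> x $ i < 1}"

definition doubling :: "(nat \<Rightarrow> real ^ 'd) \<Rightarrow> bool"
  where "doubling r \<longleftrightarrow>
    (\<forall>n\<ge>1. \<forall>i. 0 < r n $ i \<and> r n $ i < 1 / 2) \<and>
    (\<forall>i. antimono_on {1..} (\<lambda>n. r n $ i)) \<and>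
    (\<exists>C>1. \<forall>i. \<forall>n\<ge>1. r n $ i \<le> C * r (2 * n) $ i)"

definition smallest_singular_value :: "real ^ 'd ^ 'd \<Rightarrow> real"
  where "smallest_singular_value A = Inf {norm (A *v x) | x. norm x = 1}"

definition fourier_transform :: "(real ^ 'd) measure \<Rightarrow> real ^ 'd \<Rightarrow> complex"
  where "fourier_transform \<mu> t =
    (\<integral>x. exp (- 2 * complex_of_real pi * \<i> * complex_of_real (t \<bullet> x)) \<partial>\<mu>)"

definition target_box :: "(nat \<Rightarrow> real ^ 'd) \<Rightarrow> nat \<Rightarrow> (real ^ 'd) set"
  where "target_box r n = {x \<in> unit_cube. \<forall>i. dist_int (x $ i) \<le> r n $ i}"

definition cong_mod_1 :: "real ^ 'd \<Rightarrow> real ^ 'd \<Rightarrow> bool"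
  where "cong_mod_1 x y \<longleftrightarrow> (\<forall>i. x $ i - y $ i \<in> \<int>)"

definition target_set ::
    "real ^ 'd \<Rightarrow> (nat \<Rightarrow> real ^ 'd ^ 'd) \<Rightarrow> (nat \<Rightarrow> real ^ 'd) \<Rightarrow> (real ^ 'd) set"
  where "target_set \<alpha> A r =
    {\<beta> \<in> unit_cube. infinite {n. n \<ge> 1 \<and> (\<exists>x\<in>target_box r n. cong_mod_1 (A n *v \<alpha>) (\<beta> + x))}}"

lemma dist_int_add_int:
  assumes "k \<in> \<int>"
  shows "dist_int (x + k) = dist_int x"
proof -
  have "dist (x + k) ` \<int> = dist x ` \<int>"
  proof (intro set_eqI iffI)
    fix y assume "y \<in> dist (x + k) ` \<int>"
    then obtain m where "m \<in> \<int>" "y = dist (x + k) m" by blast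
    then have "y = dist x (m - k)" "m - k \<in> \<int>"
      using assms by (auto simp: dist_real_def algebra_simps)
    then show "y \<in> dist x ` \<int>" by blast
  next
    fix y assume "y \<in> dist x ` \<int>"
    then obtain m where "m \<in> \<int>" "y = dist x m" by blast
    then have "y = dist (x + k) (m + k)" "m + k \<in> \<int>"
      using assms by (auto simp: dist_real_def algebra_simps)
    then show "y \<in> dist (x + k) ` \<int>" by blast
  qed
  then show ?thesis by (simp add: dist_int_def infdist_def)
qed

lemma ex_target_box_cong_iff:
  "(\<exists>x\<in>target_box r n. cong_mod_1 y (\<beta> + x)) \<longleftrightarrow> (\<forall>i. dist_int (y $ i - \<beta> $ i) \<le> r n $ i)"
proof
  assume "\<exists>x\<in>target_box r n. cong_mod_1 y (\<beta> + x)"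
  then obtain x where x: "x \<in> target_box r n" "cong_mod_1 y (\<beta> + x)" by blast
  show "\<forall>i. dist_int (y $ i - \<beta> $ i) \<le> r n $ i"
  proof
    fix i
    have "y $ i - (\<beta> + x) $ i \<in> \<int>" using x(2) by (simp add: cong_mod_1_def)
    from dist_int_add_int[OF this, of "x $ i"]
    have "dist_int (y $ i - \<beta> $ i) = dist_int (x $ i)" by simp
    then show "dist_int (y $ i - \<beta> $ i) \<le> r n $ i" using x(1) by (simp add: target_box_def)
  qed
next
  assume *: "\<forall>i. dist_int (y $ i - \<beta> $ i) \<le> r n $ i"
  define x where "x = (\<chi> i. frac (y $ i - \<beta> $ i))"
  have "dist_int (x $ i) = dist_int (y $ i - \<beta> $ i)" for i
    using dist_int_add_int[of "- of_int \<lfloor>y $ i - \<beta> $ i\<rfloor>" "y $ i - \<beta> $ i"]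
    by (simp add: x_def frac_def)
  then have "x \<in> target_box r n"
    using * by (simp add: target_box_def unit_cube_def x_def frac_lt_1)
  moreover have "cong_mod_1 y (\<beta> + x)"
    by (simp add: cong_mod_1_def x_def frac_def)
  ultimately show "\<exists>x\<in>target_box r n. cong_mod_1 y (\<beta> + x)" by blast
qed

end

theory Submission
  imports Defs
begin

text \<open>
  Give \<open>\<beta>\<close> the uniform distribution on the unit cube, independently of \<open>\<alpha>\<close>, and let \<open>E\<^sub>n\<close> be the event that
  every coordinate of \<open>A\<^sub>n \<alpha> - \<beta>\<close> is within \<open>r\<^sub>i(n)\<close> of an integer.  For each fixed \<open>\<alpha>\<close> the
  probability of \<open>E\<^sub>n\<close> is \<open>p\<^sub>n = \<Prod>\<^sub>i 2 r\<^sub>i(n)\<close>, so the convergence case is the first Borel--Cantelli lemma,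
  applied in \<open>\<beta>\<close> alone.

  For the divergence case it suffices, by Fubini, that almost surely infinitely many \<open>E\<^sub>n\<close> occur.
  This follows by Chebyshev's inequality once the number of events that occur among the first \<open>N\<close> has
  variance of the order of its mean (\<open>AE_infinitely_often_of_weak_correlation\<close>).  To estimate the
  covariance of \<open>E\<^sub>n\<close> and \<open>E\<^sub>m\<close>, integrate over \<open>\<beta>\<close> first.  The result is the volume of
  the intersection of two boxes on the torus whose centres differ by \<open>x = (A\<^sub>n - A\<^sub>m) \<alpha>\<close>
  (\<open>measure_box_overlap\<close>).  As a function of \<open>x\<close> this volume is a convolution of two box indicators,
  so it has an absolutely convergent Fourier series \<open>\<Sum>\<^sub>k C\<^sub>k e(k \<bullet> x)\<close> with \<open>C\<^sub>0 = p\<^sub>n p\<^sub>m\<close>, where Parseval's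
  identity for each indicator gives \<open>\<Sum>\<^sub>k \<bar>C\<^sub>k\<bar> \<le> (p\<^sub>n + p\<^sub>m) / 2\<close> (\<open>box_corr_fourier\<close>).  Integrating over \<open>\<alpha>\<close> turns
  each exponential into the value of the Fourier transform of \<open>\<mu>\<close> at \<open>-(A\<^sub>n - A\<^sub>m)\<^sup>T k\<close>.  For integral
  \<open>k \<noteq> 0\<close> this frequency is at least as long as the smallest singular value of \<open>A\<^sub>n - A\<^sub>m\<close>, so the decay of
  the transform and the gap hypothesis bound the value by a constant times \<open>1 / (j log\<^sub>+(j)\<^bsup>1 + s\<epsilon>\<^esup>)\<close>
  with \<open>j = \<bar>n - m\<bar>\<close>.  That sequence is summable in \<open>j\<close>, which is exactly what makes
  the variance comparable to the mean.
\<close>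

section \<open>The Fourier series of a periodic parabola\<close>

text \<open>
  Up to an affine change this is the periodic Bernoulli polynomial of degree two.  It is an
  antiderivative of the sawtooth \<open>1 - 2 frac y\<close>, and the indicator of an arc is a difference of two
  sawtooth functions plus a constant, which is why all overlaps of arcs are expressed through it.
\<close>
definition parab :: "real \<Rightarrow> real"
  where "parab y = frac y * (1 - frac y)"

lemma Im_Ln_one_minus_cis:
  assumes "0 < x" "x < 2 * pi"
  shows "Im (Ln (1 - cis x)) = (x - pi) / 2"
proof -
  have s: "sin (x / 2) > 0" using assms by (intro sin_gt_zero) auto
  have "cos ((x - pi) / 2) = sin (x / 2)" "sin ((x - pi) / 2) = - cos (x / 2)"
    by (simp_all add: diff_divide_distrib cos_diff sin_diff)
  moreover have "cos x = 1 - 2 * sin (x/2) ^ 2" "sin x = 2 * sin (x/2) * cos (x/2)"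
    using cos_double_sin[of "x/2"] sin_double[of "x/2"] by simp_all
  ultimately have "1 - cis x = exp (Complex (ln (2 * sin (x / 2))) ((x - pi) / 2))"
    using s by (simp add: complex_eq_iff Re_exp Im_exp power2_eq_square)
  then show ?thesis using assms by (simp add: Ln_exp)
qed

lemma sine_log_series:
  assumes "0 \<le> \<rho>" "\<rho> < 1"
  shows "(\<lambda>n. \<rho> ^ n * sin (real n * x) / real n) sums (- Im (Ln (1 - of_real \<rho> * cis x)))"
proof -
  have "cmod (- (of_real \<rho> * cis x)) < 1" using assms by (simp add: norm_mult)
  from Ln_series'[OF this]
  have "(\<lambda>n. Im (- ((of_real \<rho> * cis x) ^ n) / of_nat n)) sums Im (Ln (1 - of_real \<rho> * cis x))"
    by (intro sums_Im) simp
  then have "(\<lambda>n. - Im (- ((of_real \<rho> * cis x) ^ n) / of_nat n)) sums (- Im (Ln (1 - of_real \<rho> * cis x)))"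
    by (rule sums_minus)
  moreover have "- Im (- ((of_real \<rho> * cis x) ^ n) / of_nat n) = \<rho> ^ n * sin (real n * x) / real n" for n
    by (simp add: power_mult_distrib Complex.DeMoivre flip: of_real_power)
  ultimately show ?thesis by (simp only:)
qed

text \<open>
  The series with factors \<open>\<rho>\<^sup>n\<close>, \<open>\<rho> < 1\<close>, may be differentiated term by term; its derivative is minus the
  imaginary part of \<open>Ln (1 - \<rho> cis x)\<close>.  This is bounded by \<open>\<pi>\<close> uniformly in \<open>\<rho>\<close> and tends to
  \<open>(\<pi> - x) / 2\<close> as \<open>\<rho> \<rightarrow> 1\<close>, so dominated convergence identifies the limit of the sums as the integral of
  \<open>(\<pi> - x) / 2\<close>, while Tannery's theorem identifies it as the series at \<open>\<rho> = 1\<close>.  The term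
  with \<open>n = 0\<close> is \<open>0 / 0 = 0\<close>.
\<close>
lemma parabola_sums:
  assumes x: "0 \<le> x" "x < 2 * pi"
  shows "(\<lambda>n. (1 - cos (real n * x)) / (real n)\<^sup>2) sums (pi * x / 2 - x\<^sup>2 / 4)"
proof -
  define a where "a = (\<lambda>n \<rho> x. \<rho> ^ n * (1 - cos (real n * x)) / (real n)\<^sup>2)"
  define S where "S = (\<lambda>\<rho> x. \<Sum>n. a n \<rho> x)"
  define h where "h = (\<lambda>\<rho> x. - Im (Ln (1 - of_real \<rho> * cis x)))"
  have der: "(S \<rho> has_field_derivative h \<rho> t) (at t)" if "0 \<le> \<rho>" "\<rho> < 1" for \<rho> t
  proof -
    have "((\<lambda>x. \<Sum>n. a n \<rho> x) has_field_derivative (\<Sum>n. \<rho> ^ n * sin (real n * t) / real n)) (at t)"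
    proof (rule has_field_derivative_series'(2)[where S = UNIV and ?x0.0 = 0])
      show "(a n \<rho> has_field_derivative \<rho> ^ n * sin (real n * x) / real n) (at x within UNIV)" for n x
        unfolding a_def by (cases "n = 0") (auto intro!: derivative_eq_intros simp: field_simps power2_eq_square)
      show "uniformly_convergent_on UNIV (\<lambda>n x. \<Sum>i<n. \<rho> ^ i * sin (real i * x) / real i)"
      proof (rule Weierstrass_m_test'[where M = "\<lambda>n. \<rho> ^ n"])
        show "norm (\<rho> ^ n * sin (real n * x) / real n) \<le> \<rho> ^ n" for n x
        proof (cases "n = 0")
          case False
          have "\<bar>\<rho> ^ n * sin (real n * x)\<bar> \<le> \<rho> ^ n * 1"
            unfolding abs_mult using that by (intro mult_mono) auto
          also have "\<dots> \<le> \<rho> ^ n * real n" using that False by (intro mult_left_mono) auto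
          finally show ?thesis using False by (simp add: divide_simps)
        qed (use that in simp)
      qed (use that in simp)
      show "summable (\<lambda>n. a n \<rho> 0)" by (simp add: a_def)
    qed auto
    then show ?thesis
      using sums_unique[OF sine_log_series[OF that, of t]] by (simp add: S_def[abs_def] h_def)
  qed
  have int: "(h \<rho> has_integral S \<rho> x) {0..x}" if "0 \<le> \<rho>" "\<rho> < 1" for \<rho>
  proof -
    have "(h \<rho> has_integral (S \<rho> x - S \<rho> 0)) {0..x}"
      using x der[OF that]
      by (intro fundamental_theorem_of_calculus)
         (auto simp: has_real_derivative_iff_has_vector_derivative[symmetric] intro: has_field_derivative_at_within)
    then show ?thesis by (simp add: S_def a_def)
  qed
  define \<rho> where "\<rho> = (\<lambda>n::nat. 1 - 1 / (real n + 1))"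
  have \<rho>: "0 \<le> \<rho> n" "\<rho> n < 1" for n by (auto simp: \<rho>_def)
  have \<rho>_lim: "\<rho> \<longlonglongrightarrow> 1"
    using tendsto_diff[OF tendsto_const[of 1] LIMSEQ_inverse_real_of_nat]
    by (simp add: \<rho>_def inverse_eq_divide add.commute)
  \<comment> \<open>At \<open>t = 0\<close> every \<open>h \<rho>\<close> vanishes, so the pointwise limit jumps there.\<close>
  define g where "g = (\<lambda>t. if t = 0 then 0 else (pi - t) / 2)"
  have "(\<lambda>k. integral {0..x} (h (\<rho> k))) \<longlonglongrightarrow> integral {0..x} g"
  proof (rule dominated_convergence)
    show "h (\<rho> k) integrable_on {0..x}" for k using int[OF \<rho>] by blast
    show "(\<lambda>_. pi) integrable_on {0..x}" by (rule integrable_const_ivl)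
    show "norm (h (\<rho> k) t) \<le> pi" if "t \<in> {0..x}" for k t
    proof -
      \<comment> \<open>The point \<open>1 - \<rho> cis t\<close> is nonzero, so its principal argument lies between \<open>-\<pi>\<close> and \<open>\<pi>\<close>.\<close>
      have "Re (of_real (\<rho> k) * cis t) \<le> \<rho> k * 1"
        unfolding Re_complex_of_real by (simp, intro mult_left_le) (use \<rho> in auto)
      then have "1 - of_real (\<rho> k) * cis t \<noteq> 0" using \<rho>[of k] by (auto simp: complex_eq_iff)
      then show ?thesis
        using mpi_less_Im_Ln[of "1 - of_real (\<rho> k) * cis t"] Im_Ln_le_pi[of "1 - of_real (\<rho> k) * cis t"]
        by (auto simp: h_def abs_le_iff)
    qed
    show "(\<lambda>k. h (\<rho> k) t) \<longlonglongrightarrow> g t" if t: "t \<in> {0..x}" for t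
    proof (cases "t = 0")
      case True
      have "h (\<rho> k) 0 = - Im (Ln (of_real (1 - \<rho> k)))" for k by (simp add: h_def)
      then have "h (\<rho> k) 0 = 0" for k using \<rho>[of k] by (simp only: Ln_of_real) simp
      then show ?thesis using True by (simp add: g_def)
    next
      case False
      have "cos t < 1"
      proof -
        have "sin (t/2) > 0" using t x False by (intro sin_gt_zero) auto
        then show ?thesis using cos_double_sin[of "t/2"] by simp
      qed
      then have "1 - of_real 1 * cis t \<notin> \<real>\<^sub>\<le>\<^sub>0" by (auto simp: complex_nonpos_Reals_iff)
      then have "(\<lambda>k. h (\<rho> k) t) \<longlonglongrightarrow> h 1 t"
        unfolding h_def by (intro tendsto_intros \<rho>_lim)
      also have "h 1 t = g t"
        using False t x Im_Ln_one_minus_cis[of t] by (simp add: g_def h_def field_simps)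
      finally show ?thesis .
    qed
  qed
  moreover have "integral {0..x} (h (\<rho> k)) = S (\<rho> k) x" for k using int[OF \<rho>] by blast
  moreover have "(g has_integral (pi * x / 2 - x\<^sup>2 / 4)) {0..x}"
  proof -
    have "((\<lambda>t. (pi - t) / 2) has_integral ((pi * x / 2 - x\<^sup>2 / 4) - (pi * 0 / 2 - 0\<^sup>2 / 4))) {0..x}"
      using x by (intro fundamental_theorem_of_calculus)
         (auto simp: has_real_derivative_iff_has_vector_derivative[symmetric] intro!: derivative_eq_intros)
    then have "((\<lambda>t. (pi - t) / 2) has_integral (pi * x / 2 - x\<^sup>2 / 4)) {0..x}" by simp
    then show ?thesis
      by (rule has_integral_spike[of "{0}", rotated 2]) (auto simp: g_def)
  qed
  ultimately have lim1: "(\<lambda>k. S (\<rho> k) x) \<longlonglongrightarrow> pi * x / 2 - x\<^sup>2 / 4"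
    by (simp add: integral_unique)
  have "summable (\<lambda>n. 2 * inverse (real n ^ 2))"
    by (intro summable_mult inverse_power_summable) auto
  then have "eventually (\<lambda>k. summable (\<lambda>n. norm (a n (\<rho> k) x))) sequentially \<and>
        summable (\<lambda>n. norm (a n 1 x)) \<and> ((\<lambda>k. \<Sum>n. a n (\<rho> k) x) \<longlonglongrightarrow> (\<Sum>n. a n 1 x))"
  proof (rule tannerys_theorem[rotated 2])
    show "(\<lambda>k. a n (\<rho> k) x) \<longlonglongrightarrow> a n 1 x" for n
      unfolding a_def by (cases "n = 0") (auto intro!: tendsto_eq_intros \<rho>_lim)
    have "norm (a n (\<rho> k) x) \<le> 2 * inverse (real n ^ 2)" for n k
    proof -
      have "\<rho> k ^ n * (1 - cos (real n * x)) \<le> 1 * 2"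
        using \<rho>[of k] cos_ge_minus_one[of "real n * x"] by (intro mult_mono power_le_one) auto
      moreover have "0 \<le> \<rho> k ^ n * (1 - cos (real n * x))" using \<rho>[of k] by simp
      ultimately show ?thesis unfolding a_def by (simp add: abs_divide divide_right_mono flip: divide_inverse)
    qed
    then show "eventually (\<lambda>(n, k). norm (a n (\<rho> k) x) \<le> 2 * inverse (real n ^ 2)) (sequentially \<times>\<^sub>F sequentially)"
      by (simp add: case_prod_unfold)
  qed auto
  then have "summable (\<lambda>n. a n 1 x)" "(\<lambda>k. S (\<rho> k) x) \<longlonglongrightarrow> (\<Sum>n. a n 1 x)"
    unfolding S_def by (auto dest: summable_rabs_cancel)
  with LIMSEQ_unique[OF lim1] have "(\<lambda>n. a n 1 x) sums (pi * x / 2 - x\<^sup>2 / 4)"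
    by (auto simp: sums_iff)
  then show ?thesis by (simp add: a_def)
qed

lemma parab_sums:
  "(\<lambda>n. (1 - cos (2 * pi * real n * y)) / (pi * real n)\<^sup>2) sums parab y"
proof -
  have *: "cos (real n * (2 * pi * frac y)) = cos (2 * pi * real n * y)" for n
  proof -
    have "real n * (2 * pi * frac y) = 2 * pi * real n * y - 2 * pi * of_int (int n * \<lfloor>y\<rfloor>)"
      by (simp add: frac_def algebra_simps)
    then show ?thesis
      using cos_int_2pin[of "int n * \<lfloor>y\<rfloor>"] sin_int_2pin[of "int n * \<lfloor>y\<rfloor>"]
      by (simp only: cos_diff mult_1_right mult_zero_right add_0_right)
  qed
  have "(\<lambda>n. (1 - cos (real n * (2 * pi * frac y))) / (real n)\<^sup>2 / pi\<^sup>2) sums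
      ((pi * (2 * pi * frac y) / 2 - (2 * pi * frac y)\<^sup>2 / 4) / pi\<^sup>2)"
    by (intro sums_divide parabola_sums) (simp_all add: frac_lt_1)
  also have "(pi * (2 * pi * frac y) / 2 - (2 * pi * frac y)\<^sup>2 / 4) / pi\<^sup>2 = parab y"
    by (simp add: parab_def field_simps power2_eq_square)
  finally show ?thesis unfolding * by (simp add: power_mult_distrib mult.commute)
qed

section \<open>The overlap of two arcs of the circle\<close>

lemma dist_int_eq_min_frac: "dist_int x = min (frac x) (1 - frac x)"
proof (rule antisym)
  have "dist_int x \<le> dist x (of_int \<lfloor>x\<rfloor>)" "dist_int x \<le> dist x (of_int (\<lfloor>x\<rfloor> + 1))"
    unfolding dist_int_def by (rule infdist_le, rule Ints_of_int)+
  then show "dist_int x \<le> min (frac x) (1 - frac x)"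
    by (simp add: dist_real_def frac_def abs_if split: if_splits) linarith
  show "min (frac x) (1 - frac x) \<le> dist_int x"
    unfolding dist_int_def infdist_def
  proof (subst if_not_P, goal_cases)
    case 2
    show ?case
    proof (rule cINF_greatest)
    fix m :: real assume "m \<in> \<int>"
    then obtain k where k: "m = of_int k" by (auto elim: Ints_cases)
    then consider "k \<le> \<lfloor>x\<rfloor>" | "k \<ge> \<lfloor>x\<rfloor> + 1" by linarith
    then show "min (frac x) (1 - frac x) \<le> dist x m"
    proof cases
      case 1
      then have "of_int k \<le> (of_int \<lfloor>x\<rfloor> :: real)" by simp
      then show ?thesis unfolding k dist_real_def frac_def by linarith
    next
      case 2
      then have "(of_int \<lfloor>x\<rfloor> :: real) + 1 \<le> of_int k" by linarith
      then show ?thesis unfolding k dist_real_def frac_def by linarith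
    qed
    qed auto
  qed auto
qed

lemma dist_int_measurable [measurable]: "dist_int \<in> borel_measurable borel"
  unfolding dist_int_def[abs_def] by (intro borel_measurable_continuous_onI continuous_intros)

lemma dist_int_minus: "dist_int (- x) = dist_int x"
proof (cases "x \<in> \<int>")
  case True
  then have "- x \<in> \<int>" by simp
  with True show ?thesis by (simp add: dist_int_eq_min_frac frac_eq_0_iff[THEN iffD2])
qed (simp add: dist_int_eq_min_frac frac_neg min.commute)

lemma parab_eq_dist_int: "parab y = dist_int y * (1 - dist_int y)"
  by (auto simp: parab_def dist_int_eq_min_frac min_def)

lemma parab_minus: "parab (- y) = parab y"
  by (simp add: parab_eq_dist_int dist_int_minus)

lemma continuous_on_parab: "continuous_on S parab"
  unfolding parab_eq_dist_int[abs_def] dist_int_def by (intro continuous_intros)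

lemma parab_has_derivative:
  assumes "y \<notin> \<int>"
  shows "(parab has_field_derivative 1 - 2 * frac y) (at y)"
proof (rule has_field_derivative_transform_within_open)
  define n where "n = \<lfloor>y\<rfloor>"
  show "((\<lambda>y. (y - n) * (1 - (y - n))) has_field_derivative 1 - 2 * frac y) (at y)"
    by (auto intro!: derivative_eq_intros simp: frac_def n_def)
  show "open {real_of_int n<..<n + 1}" by simp
  have "y \<noteq> of_int n" using assms by auto
  then show "y \<in> {real_of_int n<..<n + 1}" unfolding n_def by (simp, linarith)
  fix t assume "t \<in> {real_of_int n<..<n + 1}"
  then have "\<lfloor>t\<rfloor> = n" by (intro floor_unique) auto
  then show "(t - n) * (1 - (t - n)) = parab t" by (simp add: parab_def frac_def)
qed

text \<open>
  At the two end points of the arc the sawtooth expression takes the wrong value, hence the two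
  non-integrality assumptions; the exceptional points are negligible when integrating.
\<close>
lemma indicator_dist_int_eq_sawtooth:
  assumes a: "0 < a" "a < 1/2" and "z + a \<notin> \<int>" "z - a \<notin> \<int>"
  shows "of_bool (dist_int z \<le> a) = 2 * a + frac (z - a) - frac (z + a)"
proof -
  define f where "f = frac z"
  have f: "0 \<le> f" "f < 1" by (auto simp: f_def frac_lt_1)
  have z: "z = of_int \<lfloor>z\<rfloor> + f" by (simp add: f_def frac_def)
  have shift: "frac (z + b) = frac (f + b)" for b
  proof -
    have "z + b = f + b + of_int \<lfloor>z\<rfloor>" using z by simp
    moreover from this have "\<lfloor>z + b\<rfloor> = \<lfloor>f + b\<rfloor> + \<lfloor>z\<rfloor>" by (simp only: floor_add_int)
    ultimately show ?thesis by (simp add: frac_def)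
  qed
  have "f \<noteq> a"
  proof
    assume "f = a"
    then have "z - a = of_int \<lfloor>z\<rfloor>" using z by simp
    then show False using assms by (metis Ints_of_int)
  qed
  moreover have "f \<noteq> 1 - a"
  proof
    assume "f = 1 - a"
    then have "z + a = of_int (\<lfloor>z\<rfloor> + 1)" using z by simp
    then show False using assms by (metis Ints_of_int)
  qed
  moreover have "frac (f + a) = (if f + a < 1 then f + a else f + a - 1)"
  proof -
    have "\<lfloor>f + a\<rfloor> = (if f + a < 1 then 0 else 1)" using f a by (intro floor_unique) auto
    then show ?thesis by (simp add: frac_def)
  qed
  moreover have "frac (f - a) = (if f \<ge> a then f - a else f - a + 1)"
  proof -
    have "\<lfloor>f - a\<rfloor> = (if f \<ge> a then 0 else - 1)" using f a by (intro floor_unique) auto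
    then show ?thesis by (simp add: frac_def)
  qed
  ultimately show ?thesis
    using shift[of a] shift[of "- a"] f a
    by (auto simp: dist_int_eq_min_frac f_def[symmetric])
qed

text \<open>
  The length of the intersection of the arcs of radii \<open>a, b < 1/2\<close> on the circle of length one, when
  their centres are \<open>x\<close> apart.  This closed form remains valid when the two arcs together wrap around
  the circle and meet at both ends.
\<close>
definition arc_corr :: "real \<Rightarrow> real \<Rightarrow> real \<Rightarrow> real"
  where "arc_corr a b x = 4 * a * b +
    (parab (x + a + b) + parab (x - a - b) - parab (x + a - b) - parab (x - a + b)) / 2"

lemma finite_translated_ints:
  fixes c d z :: real
  shows "finite {t \<in> {c..d}. z - t \<in> \<int>}"
proof -
  have "{t \<in> {c..d}. z - t \<in> \<int>} \<subseteq> (\<lambda>m. z - m) ` {m \<in> \<int>. z - d \<le> m \<and> m \<le> z - c}"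
  proof
    fix t assume "t \<in> {t \<in> {c..d}. z - t \<in> \<int>}"
    then show "t \<in> (\<lambda>m. z - m) ` {m \<in> \<int>. z - d \<le> m \<and> m \<le> z - c}"
      by (intro image_eqI[of _ _ "z - t"] CollectI conjI diff_left_mono) auto
  qed
  then show ?thesis using finite_int_segment finite_surj by blast
qed

text \<open>The integrand is a sawtooth combination outside finitely many points, and \<open>parab\<close> is the antiderivative of each sawtooth.\<close>
lemma arc_integral:
  assumes a: "0 < a" "a < 1/2" and b: "0 < b"
  shows "((\<lambda>t. of_bool (dist_int (y - t) \<le> a)) has_integral arc_corr a b (y - y')) {y' - b..y' + b}"
proof -
  define \<Phi> where "\<Phi> = (\<lambda>t. 2 * a * t - (parab (y + a - t) - parab (y - a - t)) / 2)"
  define S where "S = {t \<in> {y' - b..y' + b}. y + a - t \<in> \<int>} \<union> {t \<in> {y' - b..y' + b}. y - a - t \<in> \<int>}"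
  have "((\<lambda>t. of_bool (dist_int (y - t) \<le> a)) has_integral (\<Phi> (y' + b) - \<Phi> (y' - b))) {y' - b..y' + b}"
  proof (rule fundamental_theorem_of_calculus_strong)
    show "finite S" unfolding S_def by (intro finite_UnI finite_translated_ints)
    show "y' - b \<le> y' + b" using b by simp
    show "continuous_on {y' - b..y' + b} \<Phi>"
      unfolding \<Phi>_def
      by (intro continuous_intros continuous_on_compose2[OF continuous_on_parab[of UNIV]]) auto
    fix t assume t: "t \<in> {y' - b..y' + b} - S"
    then have n: "y + a - t \<notin> \<int>" "y - a - t \<notin> \<int>" by (auto simp: S_def)
    have e: "y - t + a = y + a - t" "y - t - a = y - a - t" by auto
    have "((\<lambda>t. parab (z - t)) has_field_derivative (1 - 2 * frac (z - t)) * (0 - 1)) (at t)"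
      if "z - t \<notin> \<int>" for z
      by (rule DERIV_chain2[where g = "\<lambda>t. z - t" and f = parab, OF parab_has_derivative[OF that]]) (auto intro!: derivative_eq_intros)
    note [derivative_intros] = this[OF n(1)] this[OF n(2)]
    have "(\<Phi> has_field_derivative of_bool (dist_int (y - t) \<le> a)) (at t)"
      unfolding \<Phi>_def
      by (rule derivative_eq_intros refl | simp)+
         (use indicator_dist_int_eq_sawtooth[OF a, of "y - t"] n in \<open>auto simp: e field_simps\<close>)
    then show "(\<Phi> has_vector_derivative of_bool (dist_int (y - t) \<le> a)) (at t)"
      by (simp add: has_real_derivative_iff_has_vector_derivative)
  qed
  also have "\<Phi> (y' + b) - \<Phi> (y' - b) = arc_corr a b (y - y')"
    unfolding \<Phi>_def arc_corr_def by (simp add: field_simps)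
  finally show ?thesis .
qed

lemma integral_unit_period:
  fixes h :: "real \<Rightarrow> real"
  assumes int: "\<And>a b. h integrable_on {a..b}" and per: "\<And>x. h (x + 1) = h x"
  shows "integral {c..c + 1} h = integral {0..1} h"
proof -
  interpret periodic_fun_simple' h by unfold_locales (rule per)
  define n where "n = \<lfloor>c\<rfloor>"
  have n: "of_int n \<le> c" "c \<le> of_int n + 1" unfolding n_def by linarith+
  have shift: "integral {a + of_int k..b + of_int k} h = integral {a..b} h" for a b k
  proof -
    have "h \<circ> (+) (of_int k) = h" by (auto simp: fun_eq_iff plus_of_int add.commute)
    then show ?thesis using integral_shift_Icc_real[of a b h "of_int k"] by simp
  qed
  have "integral {c..c + 1} h = integral {c..of_int n + 1} h + integral {of_int n + 1..c + 1} h"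
    using n by (intro Henstock_Kurzweil_Integration.integral_combine[symmetric] int) auto
  also have "integral {of_int n + 1..c + 1} h = integral {of_int n..c} h"
    using shift[of "of_int n" 1 c] by simp
  also have "integral {c..of_int n + 1} h + integral {of_int n..c} h = integral {of_int n..of_int n + 1} h"
    using n by (subst add.commute, intro Henstock_Kurzweil_Integration.integral_combine int) auto
  also have "\<dots> = integral {0..1} h" using shift[of 0 n 1] by (simp add: add.commute)
  finally show ?thesis .
qed

text \<open>
  By periodicity the unit interval may be replaced by the one centred at \<open>y'\<close>.  There, since \<open>b < 1/2\<close>, the
  second condition describes the interval \<open>{y' - b..y' + b}\<close>, and \<open>arc_integral\<close> applies.
\<close>
lemma measure_two_arcs:
  assumes a: "0 < a" "a < 1/2" and b: "0 < b" "b < 1/2"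
  shows "emeasure lborel {t \<in> {0..<1}. dist_int (y - t) \<le> a \<and> dist_int (y' - t) \<le> b}
    = ennreal (arc_corr a b (y - y'))" and "arc_corr a b (y - y') \<ge> 0"
proof -
  define A where "A = {t. dist_int (y - t) \<le> a \<and> dist_int (y' - t) \<le> b}"
  have [measurable]: "A \<in> sets borel" unfolding A_def by measurable
  define h where "h = (indicator A :: real \<Rightarrow> real)"
  have int: "h integrable_on {p..q}" for p q
  proof -
    have "integrable lborel (indicator (A \<inter> {p..q}) :: real \<Rightarrow> real)"
      by (intro integrable_real_indicator)
         (auto intro: le_less_trans[OF emeasure_mono[of _ "{p..q}"]] simp: emeasure_lborel_Icc_eq)
    then have "(indicator (A \<inter> {p..q}) :: real \<Rightarrow> real) integrable_on UNIV"
      using has_integral_integral_lborel by blast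
    moreover have "indicator (A \<inter> {p..q}) = (\<lambda>x. if x \<in> {p..q} then h x else 0)"
      by (auto simp: h_def indicator_def fun_eq_iff)
    ultimately show ?thesis by (simp only: integrable_restrict_UNIV)
  qed
  have per: "h (x + 1) = h x" for x
  proof -
    have "dist_int (z - (x + 1)) = dist_int (z - x)" for z
    proof -
      have "z - (x + 1) = (z - x) + (- 1)" by simp
      then show ?thesis by (simp only: dist_int_add_int[OF Ints_minus[OF Ints_1]])
    qed
    then show ?thesis by (simp add: h_def A_def indicator_def)
  qed
  have "integral {0..1} h = integral {y' - 1/2..y' - 1/2 + 1} h"
    by (rule integral_unit_period[OF int per, symmetric])
  also have "\<dots> = arc_corr a b (y - y')"
  proof (rule integral_unique)
    have iff: "dist_int (y' - t) \<le> b \<longleftrightarrow> t \<in> {y' - b..y' + b}" if "t \<in> {y' - 1/2<..<y' - 1/2 + 1}" for t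
    proof -
      have "\<lfloor>y' - t\<rfloor> = (if t \<le> y' then 0 else - 1)" using that by (intro floor_unique) auto
      then show ?thesis using that b by (auto simp: dist_int_eq_min_frac frac_def)
    qed
    have "((\<lambda>t. if t \<in> {y' - b..y' + b} then of_bool (dist_int (y - t) \<le> a) else 0) has_integral arc_corr a b (y - y')) {y' - 1/2..y' - 1/2 + 1}"
      using b by (subst has_integral_restrict) (auto intro: arc_integral[OF a b(1)])
    then show "(h has_integral arc_corr a b (y - y')) {y' - 1/2..y' - 1/2 + 1}"
    proof (rule has_integral_spike[rotated 2])
      show "negligible {y' - 1/2, y' + 1/2}" by simp
      fix t assume t: "t \<in> {y' - 1/2..y' - 1/2 + 1} - {y' - 1/2, y' + 1/2}"
      then have "t \<in> {y' - 1/2<..<y' - 1/2 + 1}" by auto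
      from iff[OF this] show "h t = (if t \<in> {y' - b..y' + b} then of_bool (dist_int (y - t) \<le> a) else 0)"
        by (auto simp: h_def A_def indicator_def)
    qed
  qed
  finally have "(h has_integral arc_corr a b (y - y')) {0..1}" using int by (metis has_integral_integral)
  then have "((\<lambda>x. if x \<in> {0..1} then h x else 0) has_integral arc_corr a b (y - y')) UNIV"
    by (simp only: has_integral_restrict_UNIV)
  also have "(\<lambda>x. if x \<in> {0..1} then h x else 0) = (\<lambda>x. if x \<in> A \<inter> {0..1} then 1 else 0)"
    by (auto simp: h_def indicator_def)
  finally have hi: "((\<lambda>x. 1) has_integral arc_corr a b (y - y')) (A \<inter> {0..1})"
    by (simp only: has_integral_restrict_UNIV)
  then show nn: "arc_corr a b (y - y') \<ge> 0" by (rule has_integral_nonneg) simp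
  have "emeasure lborel (A \<inter> {0..1}) = ennreal (arc_corr a b (y - y'))"
    using has_integral_iff_emeasure_lborel[OF _ nn, of "A \<inter> {0..1}"] hi by simp
  moreover have "emeasure lborel (A \<inter> {0..1}) = emeasure lborel (A \<inter> {0..<1})"
  proof (rule emeasure_eq_AE)
    show "AE t in lborel. (t \<in> A \<inter> {0..1}) = (t \<in> A \<inter> {0..<1})"
      using AE_lborel_singleton[of "1::real"] by eventually_elim auto
  qed simp_all
  moreover have "A \<inter> {0..<1} = {t \<in> {0..<1}. dist_int (y - t) \<le> a \<and> dist_int (y' - t) \<le> b}"
    by (auto simp: A_def)
  ultimately show "emeasure lborel {t \<in> {0..<1}. dist_int (y - t) \<le> a \<and> dist_int (y' - t) \<le> b}
    = ennreal (arc_corr a b (y - y'))" by (simp only:)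
qed

section \<open>Fourier series of overlaps\<close>

text \<open>The Fourier coefficients of the indicator of the arc of radius \<open>a\<close> centred at zero.\<close>
definition arc_coeff :: "real \<Rightarrow> int \<Rightarrow> real"
  where "arc_coeff a k = (if k = 0 then 2 * a else sin (2 * pi * of_int k * a) / (pi * of_int k))"

lemma arc_coeff_minus: "arc_coeff a (- k) = arc_coeff a k"
  by (simp add: arc_coeff_def)

lemma has_sum_int_by_sums:
  fixes F :: "int \<Rightarrow> 'a::banach"
  assumes "summable (\<lambda>n. norm (F (int (Suc n))))" "summable (\<lambda>n. norm (F (- int (Suc n))))"
    and "(\<lambda>n. F (int (Suc n)) + F (- int (Suc n))) sums s"
  shows "(F has_sum (F 0 + s)) UNIV"
proof -
  define s1 where "s1 = (\<Sum>n. F (int (Suc n)))"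
  define s2 where "s2 = (\<Sum>n. F (- int (Suc n)))"
  have sm: "(\<lambda>n. F (int (Suc n))) sums s1" "(\<lambda>n. F (- int (Suc n))) sums s2"
    unfolding s1_def s2_def using assms(1,2) by (blast intro: summable_sums summable_norm_cancel)+
  have "((F \<circ> (\<lambda>n. int (Suc n))) has_sum s1) UNIV" "((F \<circ> (\<lambda>n. - int (Suc n))) has_sum s2) UNIV"
    using norm_summable_imp_has_sum[OF assms(1) sm(1)] norm_summable_imp_has_sum[OF assms(2) sm(2)]
    by (simp_all add: o_def)
  then have pn: "(F has_sum s1) (range (\<lambda>n. int (Suc n)))" "(F has_sum s2) (range (\<lambda>n. - int (Suc n)))"
    by (simp_all add: has_sum_reindex inj_on_def)
  have "(F has_sum F 0) {0}" using has_sum_finite[of "{0}" F] by simp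
  then have "(F has_sum (F 0 + s1 + s2)) ({0} \<union> range (\<lambda>n. int (Suc n)) \<union> range (\<lambda>n. - int (Suc n)))"
    by (intro has_sum_Un_disjoint pn) auto
  also have "{0} \<union> range (\<lambda>n. int (Suc n)) \<union> range (\<lambda>n. - int (Suc n)) = UNIV"
  proof -
    have "k \<in> {0} \<union> range (\<lambda>n. int (Suc n)) \<union> range (\<lambda>n. - int (Suc n))" for k
    proof (cases k rule: int_cases3)
      case (pos n)
      then show ?thesis by (cases n) auto
    next
      case (neg n)
      then show ?thesis by (cases n) auto
    qed auto
    then show ?thesis by blast
  qed
  also have "F 0 + s1 + s2 = F 0 + s"
    using sums_unique2[OF sums_add[OF sm] assms(3)] by simp
  finally show ?thesis .
qed

text \<open>
  The four parabolas in \<open>arc_corr\<close> enter with signs that add up to zero, so the constant terms of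
  their cosine series cancel.  The product formulas for sine and cosine collect what remains into
  \<open>2 cos (2 \<pi> n x) sin (2 \<pi> n a) sin (2 \<pi> n b) / (\<pi> n)\<^sup>2\<close>, which is the sum of the terms with indices \<open>n\<close>
  and \<open>-n\<close>.
\<close>
lemma arc_corr_fourier:
  "((\<lambda>k. of_real (arc_coeff a k * arc_coeff b k) * cis (2 * pi * of_int k * x)) has_sum
    of_real (arc_corr a b x)) UNIV"
proof -
  define F where "F = (\<lambda>k::int. of_real (arc_coeff a k * arc_coeff b k) * cis (2 * pi * of_int k * x))"
  define q where "q = (\<lambda>n. ((1 - cos (2 * pi * real n * (x + a + b))) / (pi * real n)\<^sup>2
     + (1 - cos (2 * pi * real n * (x - a - b))) / (pi * real n)\<^sup>2
     - (1 - cos (2 * pi * real n * (x + a - b))) / (pi * real n)\<^sup>2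
     - (1 - cos (2 * pi * real n * (x - a + b))) / (pi * real n)\<^sup>2) / 2)"
  have "q sums (arc_corr a b x - 4 * a * b)"
    unfolding q_def arc_corr_def
    using sums_divide[OF sums_diff[OF sums_diff[OF sums_add[OF parab_sums[of "x + a + b"] parab_sums[of "x - a - b"]]
        parab_sums[of "x + a - b"]] parab_sums[of "x - a + b"]], of 2] by simp
  then have "(\<lambda>n. q (Suc n)) sums (arc_corr a b x - 4 * a * b)"
    by (subst sums_Suc_iff) (simp add: q_def)
  then have qs: "(\<lambda>n. of_real (q (Suc n)) :: complex) sums of_real (arc_corr a b x - 4 * a * b)"
    by (rule sums_of_real)
  have FF: "F (int (Suc n)) + F (- int (Suc n)) = of_real (q (Suc n))" for n
  proof -
    define m where "m = real (Suc n)"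
    have m: "m \<noteq> 0" by (simp add: m_def)
    define X A B where "X = 2 * pi * m * x" "A = 2 * pi * m * a" "B = 2 * pi * m * b"
    have "q (Suc n) = (- cos (X + A + B) - cos (X - A - B) + cos (X + A - B) + cos (X - A + B)) / 2 / (pi * m)\<^sup>2"
    proof -
      have "2 * pi * m * (x + a + b) = X + A + B" "2 * pi * m * (x - a - b) = X - A - B"
        "2 * pi * m * (x + a - b) = X + A - B" "2 * pi * m * (x - a + b) = X - A + B"
        by (simp_all add: X_A_B_def algebra_simps)
      then show ?thesis
        unfolding q_def m_def[symmetric] by (simp only:) (simp add: add_divide_distrib diff_divide_distrib)
    qed
    also have "- cos (X + A + B) - cos (X - A - B) + cos (X + A - B) + cos (X - A + B) = 4 * cos X * sin A * sin B"
      by (simp add: cos_add cos_diff sin_add sin_diff algebra_simps)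
    finally have q: "q (Suc n) = 2 * cos X * (sin A * sin B / (pi * m)\<^sup>2)" by simp
    have angle: "2 * pi * of_int (int (Suc n)) * x = X" "2 * pi * of_int (- int (Suc n)) * x = - X"
      by (simp_all add: X_A_B_def m_def algebra_simps)
    have coeff: "arc_coeff a (int (Suc n)) * arc_coeff b (int (Suc n)) = sin A * sin B / (pi * m)\<^sup>2"
      by (simp add: arc_coeff_def X_A_B_def m_def power2_eq_square)
    have "cis X + cis (- X) = of_real (2 * cos X)" by (simp add: complex_eq_iff)
    then show ?thesis
      unfolding F_def arc_coeff_minus angle coeff q by (simp only: of_real_mult flip: distrib_left) simp
  qed
  have "summable (\<lambda>n. inverse (real (Suc n) ^ 2))"
    by (subst summable_Suc_iff) (intro inverse_power_summable, simp)
  then have sm: "summable (\<lambda>n. 1 / (pi * real (Suc n))\<^sup>2)"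
    using summable_mult[of "\<lambda>n. inverse (real (Suc n) ^ 2)" "1 / pi^2"]
    by (simp only: power_mult_distrib) (simp add: inverse_eq_divide)
  have bound: "norm (F k) \<le> 1 / (pi * \<bar>of_int k\<bar>)\<^sup>2" if "k \<noteq> 0" for k
  proof -
    have "\<bar>sin (2 * pi * of_int k * a)\<bar> * \<bar>sin (2 * pi * of_int k * b)\<bar> \<le> 1 * 1"
      by (intro mult_mono) auto
    then show ?thesis using that
      by (simp add: F_def arc_coeff_def norm_mult norm_divide abs_mult power2_eq_square divide_right_mono)
  qed
  have "norm (F (int (Suc n))) \<le> 1 / (pi * real (Suc n))\<^sup>2" "norm (F (- int (Suc n))) \<le> 1 / (pi * real (Suc n))\<^sup>2" for n
    using bound[of "int (Suc n)"] bound[of "- int (Suc n)"] by (simp_all add: add.commute)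
  then have "summable (\<lambda>n. norm (F (int (Suc n))))" "summable (\<lambda>n. norm (F (- int (Suc n))))"
    by (auto intro: summable_comparison_test'[OF sm])
  from has_sum_int_by_sums[OF this, unfolded FF, OF qs] show ?thesis
    by (simp add: F_def arc_coeff_def)
qed

lemma arc_corr_diag: "0 < a \<Longrightarrow> a < 1/2 \<Longrightarrow> arc_corr a a 0 = 2 * a"
proof -
  assume a: "0 < a" "a < 1/2"
  then have "frac (2 * a) = 2 * a" by (intro frac_eq[THEN iffD2]) auto
  moreover have "parab (- a - a) = parab (a + a)" using parab_minus[of "a + a"] by simp
  moreover have "parab 0 = 0" by (simp add: parab_def)
  ultimately show ?thesis
    by (simp add: arc_corr_def) (simp add: parab_def algebra_simps)
qed

text \<open>The arc overlaps itself in its full length, so this is the series of \<open>arc_corr a a\<close> at zero.\<close>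
lemma arc_coeff_parseval:
  assumes "0 < a" "a < 1/2"
  shows "((\<lambda>k. (arc_coeff a k)\<^sup>2) has_sum 2 * a) UNIV"
  using has_sum_Re[OF arc_corr_fourier[of a a 0]] arc_corr_diag[OF assms]
  by (simp add: power2_eq_square)

lemma has_sum_prod_fun:
  fixes f :: "'d::finite \<Rightarrow> int \<Rightarrow> complex"
  assumes "\<And>i. (f i has_sum s i) UNIV"
  shows "((\<lambda>k. \<Prod>i\<in>UNIV. f i (k i)) has_sum (\<Prod>i\<in>UNIV. s i)) UNIV"
    and "(\<lambda>k. norm (\<Prod>i\<in>UNIV. f i (k i))) summable_on UNIV"
proof -
  have a: "(\<lambda>k. norm (f i k)) summable_on UNIV" for i
    using assms summable_on_iff_abs_summable_on_complex[of "f i" UNIV] by (auto simp: summable_on_def)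
  have U: "PiE UNIV (\<lambda>_::'d. UNIV :: int set) = UNIV" by auto
  have "Infinite_Set_Sum.abs_summable_on (\<lambda>k. \<Prod>i\<in>UNIV. f i (k i)) (PiE UNIV (\<lambda>_::'d. UNIV :: int set))"
    by (intro abs_summable_on_prod_PiE) (auto simp: a abs_summable_equivalent[symmetric])
  then show sm: "(\<lambda>k. norm (\<Prod>i\<in>UNIV. f i (k i))) summable_on UNIV"
    unfolding U abs_summable_equivalent[symmetric] .
  have "infsum (\<lambda>k. \<Prod>i\<in>UNIV. f i (k i)) UNIV = (\<Prod>i\<in>UNIV. s i)"
    using infsum_prod_PiE_abs[of UNIV f "\<lambda>_. UNIV"] a infsumI[OF assms] by (simp add: U)
  then show "((\<lambda>k. \<Prod>i\<in>UNIV. f i (k i)) has_sum (\<Prod>i\<in>UNIV. s i)) UNIV"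
    using abs_summable_summable[OF sm] has_sum_infsum by metis
qed

text \<open>
  Absolute convergence makes the tail of the series uniformly small, so the integral may be taken
  term by term.  The terms other than \<open>k0\<close> contribute at most \<open>\<eta>\<close> times the sum of the coefficients.
\<close>
lemma integral_trigonometric_series:
  fixes C :: "'k \<Rightarrow> real" and \<phi> :: "'k \<Rightarrow> 'a \<Rightarrow> complex" and g :: "'a \<Rightarrow> real"
  assumes "prob_space M" and C: "(\<lambda>k. \<bar>C k\<bar>) summable_on UNIV"
    and S: "\<And>F. finite F \<Longrightarrow> (\<Sum>k\<in>F. \<bar>C k\<bar>) \<le> S"
    and g: "\<And>x. x \<in> space M \<Longrightarrow> ((\<lambda>k. of_real (C k) * \<phi> k x) has_sum of_real (g x)) UNIV"
    and gm: "g \<in> borel_measurable M"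
    and \<phi>m: "\<And>k. \<phi> k \<in> borel_measurable M"
    and \<phi>1: "\<And>k x. norm (\<phi> k x) \<le> 1"
    and \<phi>0: "\<And>x. \<phi> k0 x = 1"
    and \<eta>: "\<And>k. k \<noteq> k0 \<Longrightarrow> norm (\<integral>x. \<phi> k x \<partial>M) \<le> \<eta>" "\<eta> \<ge> 0"
  shows "\<bar>(\<integral>x. g x \<partial>M) - C k0\<bar> \<le> \<eta> * S"
proof (rule field_le_epsilon)
  interpret prob_space M by fact
  fix e :: real assume "e > 0"
  define T where "T = infsum (\<lambda>k. \<bar>C k\<bar>) UNIV"
  have T: "((\<lambda>k. \<bar>C k\<bar>) has_sum T) UNIV" unfolding T_def using C by (rule has_sum_infsum)
  have "eventually (\<lambda>F. dist (\<Sum>k\<in>F. \<bar>C k\<bar>) T < e) (finite_subsets_at_top UNIV)"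
    using T \<open>e > 0\<close> unfolding has_sum_def tendsto_iff by auto
  then obtain F0 where F0: "finite F0"
    "\<And>F. finite F \<Longrightarrow> F0 \<subseteq> F \<Longrightarrow> dist (\<Sum>k\<in>F. \<bar>C k\<bar>) T < e"
    unfolding eventually_finite_subsets_at_top by auto
  define F where "F = insert k0 F0"
  have F: "finite F" "k0 \<in> F" "dist (\<Sum>k\<in>F. \<bar>C k\<bar>) T < e" using F0 by (auto simp: F_def)
  define R where "R = (\<lambda>x. of_real (g x) - (\<Sum>k\<in>F. of_real (C k) * \<phi> k x))"
  have Rb: "norm (R x) \<le> e" if x: "x \<in> space M" for x
  proof -
    have tail: "((\<lambda>k. of_real (C k) * \<phi> k x) has_sum R x) (UNIV - F)"
      unfolding R_def using F(1) by (intro has_sum_Diff g x has_sum_finite) auto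
    have tailC: "((\<lambda>k. \<bar>C k\<bar>) has_sum (T - (\<Sum>k\<in>F. \<bar>C k\<bar>))) (UNIV - F)"
      using F(1) by (intro has_sum_Diff T has_sum_finite) auto
    have "norm (of_real (C k) * \<phi> k x) \<le> \<bar>C k\<bar>" for k
      using \<phi>1[of k x] by (simp add: norm_mult mult_left_le)
    then have "norm (R x) \<le> T - (\<Sum>k\<in>F. \<bar>C k\<bar>)"
      by (intro norm_infsum_le[OF tail tailC]) auto
    then show ?thesis using F(3) by (simp add: dist_real_def)
  qed
  have \<phi>i: "integrable M (\<phi> k)" for k
    by (rule integrable_const_bound[where B = 1]) (auto simp: \<phi>m \<phi>1)
  have Rm: "R \<in> borel_measurable M" unfolding R_def using gm \<phi>m by measurable
  have Ri: "integrable M R"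
    by (rule integrable_const_bound[where B = e]) (auto simp: Rm Rb)
  have geq: "of_real (g x) = R x + (\<Sum>k\<in>F. of_real (C k) * \<phi> k x)" for x by (simp add: R_def)
  have "complex_of_real (\<integral>x. g x \<partial>M) = (\<integral>x. R x + (\<Sum>k\<in>F. of_real (C k) * \<phi> k x) \<partial>M)"
    unfolding integral_complex_of_real[symmetric] geq ..
  also have "\<dots> = (\<integral>x. R x \<partial>M) + (\<Sum>k\<in>F. of_real (C k) * (\<integral>x. \<phi> k x \<partial>M))"
    using Ri \<phi>i by (simp add: Bochner_Integration.integral_sum)
  also have "(\<Sum>k\<in>F. of_real (C k) * (\<integral>x. \<phi> k x \<partial>M)) =
      of_real (C k0) + (\<Sum>k\<in>F - {k0}. of_real (C k) * (\<integral>x. \<phi> k x \<partial>M))"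
    using F(1,2) by (subst sum.remove[of _ k0]) (simp_all add: \<phi>0[abs_def] prob_space)
  finally have "complex_of_real ((\<integral>x. g x \<partial>M) - C k0) =
      (\<integral>x. R x \<partial>M) + (\<Sum>k\<in>F - {k0}. of_real (C k) * (\<integral>x. \<phi> k x \<partial>M))" by simp
  then have "\<bar>(\<integral>x. g x \<partial>M) - C k0\<bar> = norm ((\<integral>x. R x \<partial>M) + (\<Sum>k\<in>F - {k0}. of_real (C k) * (\<integral>x. \<phi> k x \<partial>M)))"
    by (metis norm_of_real)
  also have "\<dots> \<le> norm (\<integral>x. R x \<partial>M) + (\<Sum>k\<in>F - {k0}. norm (of_real (C k) * (\<integral>x. \<phi> k x \<partial>M)))"
    by (intro order_trans[OF norm_triangle_ineq] add_mono norm_sum) auto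
  also have "norm (\<integral>x. R x \<partial>M) \<le> e"
  proof -
    have "norm (\<integral>x. R x \<partial>M) \<le> (\<integral>x. norm (R x) \<partial>M)" by (rule integral_norm_bound)
    also have "\<dots> \<le> (\<integral>x. e \<partial>M)" using Ri Rb by (intro integral_mono) auto
    finally show ?thesis by (simp add: prob_space)
  qed
  also have "(\<Sum>k\<in>F - {k0}. norm (of_real (C k) * (\<integral>x. \<phi> k x \<partial>M))) \<le> (\<Sum>k\<in>F - {k0}. \<bar>C k\<bar> * \<eta>)"
    using \<eta>(1) by (intro sum_mono) (simp add: norm_mult mult_left_mono)
  also have "\<dots> = \<eta> * (\<Sum>k\<in>F - {k0}. \<bar>C k\<bar>)" by (simp add: sum_distrib_left mult.commute)
  also have "\<dots> \<le> \<eta> * S"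
    using S[of "F - {k0}"] F(1) \<eta>(2) by (simp add: mult_left_mono)
  finally show "\<bar>(\<integral>x. g x \<partial>M) - C k0\<bar> \<le> \<eta> * S + e" by simp
qed

lemma prod_cis: "finite I \<Longrightarrow> (\<Prod>i\<in>I. cis (f i)) = cis (\<Sum>i\<in>I. f i)"
  by (induction I rule: finite_induct) (simp_all add: cis_mult)

text \<open>
  The overlap of two boxes is the product of the overlaps of their sides, so its Fourier series is the
  product of the series of the sides, with frequencies indexed by integer vectors.  Each coefficient is
  the product of a coefficient of one box and a coefficient of the other; the inequality
  \<open>u v \<le> (u\<^sup>2 + v\<^sup>2) / 2\<close> and Parseval's identity for each box bound the sum of their absolute values.
\<close>
lemma box_corr_fourier:
  fixes a b x :: "'d::finite \<Rightarrow> real"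
  assumes a: "\<And>i. 0 < a i \<and> a i < 1/2" and b: "\<And>i. 0 < b i \<and> b i < 1/2"
  defines "C \<equiv> \<lambda>k. \<Prod>i\<in>UNIV. arc_coeff (a i) (k i) * arc_coeff (b i) (k i)"
  shows "((\<lambda>k. of_real (C k) * cis (2 * pi * (\<Sum>i\<in>UNIV. of_int (k i) * x i))) has_sum
      of_real (\<Prod>i\<in>UNIV. arc_corr (a i) (b i) (x i))) UNIV"
    and "(\<lambda>k. \<bar>C k\<bar>) summable_on UNIV"
    and "finite F \<Longrightarrow> (\<Sum>k\<in>F. \<bar>C k\<bar>) \<le> ((\<Prod>i\<in>UNIV. 2 * a i) + (\<Prod>i\<in>UNIV. 2 * b i)) / 2"
proof -
  note prod = has_sum_prod_fun[OF arc_corr_fourier, of a b x]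
  have eq: "(\<Prod>i\<in>UNIV. of_real (arc_coeff (a i) (k i) * arc_coeff (b i) (k i)) * cis (2 * pi * of_int (k i) * x i))
      = of_real (C k) * cis (2 * pi * (\<Sum>i\<in>UNIV. of_int (k i) * x i))" for k
    by (simp add: C_def prod.distrib prod_cis sum_distrib_left mult_ac)
  show "((\<lambda>k. of_real (C k) * cis (2 * pi * (\<Sum>i\<in>UNIV. of_int (k i) * x i))) has_sum
      of_real (\<Prod>i\<in>UNIV. arc_corr (a i) (b i) (x i))) UNIV"
    using prod(1) unfolding eq by simp
  show "(\<lambda>k. \<bar>C k\<bar>) summable_on UNIV"
    using prod(2) unfolding eq by (simp add: norm_mult)
  have sq: "((\<lambda>k. \<Prod>i\<in>UNIV. (arc_coeff (c i) (k i))\<^sup>2) has_sum (\<Prod>i\<in>UNIV. 2 * c i)) UNIV"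
    if "\<And>i. 0 < c i \<and> c i < 1/2" for c :: "'d \<Rightarrow> real"
  proof -
    have "((\<lambda>k. of_real ((arc_coeff (c i) k)\<^sup>2)) has_sum complex_of_real (2 * c i)) UNIV" for i
      using arc_coeff_parseval[of "c i"] that[of i] by (subst has_sum_of_real_iff) auto
    from has_sum_Re[OF has_sum_prod_fun(1)[OF this]] show ?thesis
      by (simp flip: of_real_prod del: of_real_power of_real_mult)
  qed
  show "(\<Sum>k\<in>F. \<bar>C k\<bar>) \<le> ((\<Prod>i\<in>UNIV. 2 * a i) + (\<Prod>i\<in>UNIV. 2 * b i)) / 2" if F: "finite F"
  proof -
    define u where "u = (\<lambda>c::'d \<Rightarrow> real. \<lambda>k. \<Prod>i\<in>UNIV. arc_coeff (c i) (k i))"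
    have "\<bar>C k\<bar> \<le> ((u a k)\<^sup>2 + (u b k)\<^sup>2) / 2" for k
      using sum_squares_bound[of "\<bar>u a k\<bar>" "\<bar>u b k\<bar>"]
      by (simp add: C_def u_def prod.distrib abs_mult)
    then have "(\<Sum>k\<in>F. \<bar>C k\<bar>) \<le> (\<Sum>k\<in>F. ((u a k)\<^sup>2 + (u b k)\<^sup>2) / 2)" by (rule sum_mono)
    also have "\<dots> = ((\<Sum>k\<in>F. (u a k)\<^sup>2) + (\<Sum>k\<in>F. (u b k)\<^sup>2)) / 2"
      by (simp add: sum.distrib flip: sum_divide_distrib)
    also have "(\<Sum>k\<in>F. (u a k)\<^sup>2) \<le> (\<Prod>i\<in>UNIV. 2 * a i)"
      unfolding u_def prod_power_distrib using F by (intro finite_sum_le_has_sum[OF sq[OF a]]) (auto intro: prod_nonneg)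
    also have "(\<Sum>k\<in>F. (u b k)\<^sup>2) \<le> (\<Prod>i\<in>UNIV. 2 * b i)"
      unfolding u_def prod_power_distrib using F by (intro finite_sum_le_has_sum[OF sq[OF b]]) (auto intro: prod_nonneg)
    finally show ?thesis by simp
  qed
qed

lemma matrix_vector_mult_nth_measurable [measurable]:
  fixes B :: "real ^ 'd ^ 'd"
  shows "(\<lambda>x. (B *v x) $ i) \<in> borel_measurable borel"
  by (intro borel_measurable_continuous_onI continuous_intros
      bounded_linear.continuous_on[OF matrix_vector_mul_bounded_linear])

lemma parab_measurable [measurable]: "parab \<in> borel_measurable borel"
  by (intro borel_measurable_continuous_onI continuous_on_parab)

lemma arc_corr_measurable [measurable]: "arc_corr a b \<in> borel_measurable borel"
  unfolding arc_corr_def[abs_def] by measurable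

text \<open>
  Integrating the Fourier series of the overlap at \<open>x = B \<alpha>\<close> replaces the exponential of frequency \<open>k\<close> by the Fourier
  transform of \<open>\<mu>\<close> at \<open>-B\<^sup>T k\<close>; the constant term is the product of the two volumes.
\<close>
lemma integral_box_corr:
  fixes \<mu> :: "(real ^ 'd) measure" and B :: "real ^ 'd ^ 'd" and a b :: "'d \<Rightarrow> real"
  assumes "prob_space \<mu>" and sets: "sets \<mu> = sets (restrict_space borel unit_cube)"
    and a: "\<And>i. 0 < a i \<and> a i < 1/2" and b: "\<And>i. 0 < b i \<and> b i < 1/2"
    and \<eta>: "\<eta> \<ge> 0" "\<And>k. k \<noteq> 0 \<Longrightarrow> (\<forall>i. k $ i \<in> \<int>) \<Longrightarrow> norm (fourier_transform \<mu> (- (k v* B))) \<le> \<eta>"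
  shows "\<bar>(\<integral>\<alpha>. (\<Prod>i\<in>UNIV. arc_corr (a i) (b i) ((B *v \<alpha>) $ i)) \<partial>\<mu>)
      - (\<Prod>i\<in>UNIV. 2 * a i) * (\<Prod>i\<in>UNIV. 2 * b i)\<bar>
    \<le> \<eta> * (((\<Prod>i\<in>UNIV. 2 * a i) + (\<Prod>i\<in>UNIV. 2 * b i)) / 2)"
proof -
  interpret prob_space \<mu> by fact
  have meas: "f \<in> borel_measurable \<mu>" if "f \<in> borel_measurable borel" for f :: "real ^ 'd \<Rightarrow> 'b::topological_space"
    using that measurable_restrict_space1 measurable_cong_sets[OF sets refl] by blast
  define C where "C k = (\<Prod>i\<in>UNIV. arc_coeff (a i) (k i) * arc_coeff (b i) (k i))" for k :: "'d \<Rightarrow> int"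
  define \<phi> where "\<phi> = (\<lambda>(k::'d \<Rightarrow> int) \<alpha>. cis (2 * pi * (\<Sum>i\<in>UNIV. of_int (k i) * (B *v \<alpha>) $ i)))"
  note fs = box_corr_fourier[of a b, OF a b, folded C_def]
  have \<phi>: "norm (\<integral>\<alpha>. \<phi> k \<alpha> \<partial>\<mu>) \<le> \<eta>" if "k \<noteq> (\<lambda>_. 0)" for k
  proof -
    define kv :: "real ^ 'd" where "kv = (\<chi> i. of_int (k i))"
    have "kv \<noteq> 0" using that by (auto simp: kv_def vec_eq_iff)
    have eq: "(\<Sum>i\<in>UNIV. of_int (k i) * (B *v \<alpha>) $ i) = (kv v* B) \<bullet> \<alpha>" for \<alpha>
      unfolding dot_lmul_matrix by (simp add: inner_vec_def kv_def)
    then have "\<phi> k \<alpha> = exp (- 2 * complex_of_real pi * \<i> * complex_of_real (- (kv v* B) \<bullet> \<alpha>))" for \<alpha>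
      unfolding \<phi>_def eq by (simp add: cis_conv_exp mult_ac)
    then have "(\<integral>\<alpha>. \<phi> k \<alpha> \<partial>\<mu>) = fourier_transform \<mu> (- (kv v* B))"
      by (simp add: fourier_transform_def)
    then show ?thesis using \<eta>(2)[of kv] \<open>kv \<noteq> 0\<close> by (simp add: kv_def)
  qed
  have "\<bar>(\<integral>\<alpha>. (\<Prod>i\<in>UNIV. arc_corr (a i) (b i) ((B *v \<alpha>) $ i)) \<partial>\<mu>) - C (\<lambda>_. 0)\<bar>
    \<le> \<eta> * (((\<Prod>i\<in>UNIV. 2 * a i) + (\<Prod>i\<in>UNIV. 2 * b i)) / 2)"
  proof (rule integral_trigonometric_series[where \<phi> = \<phi>])
    show "((\<lambda>k. of_real (C k) * \<phi> k \<alpha>) has_sum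
        complex_of_real (\<Prod>i\<in>UNIV. arc_corr (a i) (b i) ((B *v \<alpha>) $ i))) UNIV" for \<alpha>
      unfolding \<phi>_def by (rule fs(1))
    show "(\<lambda>\<alpha>. \<Prod>i\<in>UNIV. arc_corr (a i) (b i) ((B *v \<alpha>) $ i)) \<in> borel_measurable \<mu>"
      by (rule meas) measurable
    show "\<phi> k \<in> borel_measurable \<mu>" for k
      unfolding \<phi>_def cis_conv_exp by (rule meas) measurable
  qed (use fs(2,3) \<phi> \<eta>(1) in \<open>auto simp: prob_space_axioms \<phi>_def\<close>)
  moreover have "C (\<lambda>_. 0) = (\<Prod>i\<in>UNIV. 2 * a i) * (\<Prod>i\<in>UNIV. 2 * b i)"
    unfolding C_def arc_coeff_def by (simp only: prod.distrib simp_thms if_True)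
  ultimately show ?thesis by (simp only:)
qed

section \<open>The overlap of two boxes as a Lebesgue measure\<close>

text \<open>The conditions on the coordinates of \<open>\<beta>\<close> are independent, so Fubini reduces this to \<open>measure_two_arcs\<close>.\<close>
lemma measure_box_overlap:
  fixes y y' a b :: "real ^ 'd"
  assumes a: "\<And>i. 0 < a $ i \<and> a $ i < 1/2" and b: "\<And>i. 0 < b $ i \<and> b $ i < 1/2"
  shows "emeasure lborel {\<beta> \<in> unit_cube. \<forall>i. dist_int (y $ i - \<beta> $ i) \<le> a $ i \<and> dist_int (y' $ i - \<beta> $ i) \<le> b $ i}
    = ennreal (\<Prod>i\<in>UNIV. arc_corr (a $ i) (b $ i) (y $ i - y' $ i))"
proof -
  define D where "D = (\<lambda>i. {t \<in> {0..<1}. dist_int (y $ i - t) \<le> a $ i \<and> dist_int (y' $ i - t) \<le> b $ i})"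
  have D [measurable]: "D i \<in> sets borel" for i
  proof -
    have "{t. dist_int (y $ i - t) \<le> a $ i \<and> dist_int (y' $ i - t) \<le> b $ i} \<in> sets borel" by measurable
    moreover have "D i = {0..<1} \<inter> {t. dist_int (y $ i - t) \<le> a $ i \<and> dist_int (y' $ i - t) \<le> b $ i}"
      by (auto simp: D_def)
    ultimately show ?thesis by simp
  qed
  define f :: "real ^ 'd \<Rightarrow> real \<Rightarrow> ennreal"
    where "f = (\<lambda>e. indicator (\<Inter>i\<in>{i. e = axis i 1}. D i))"
  have fax: "f (axis i 1) = indicator (D i)" for i
  proof -
    have "{j. axis i (1::real) = axis j 1} = {i}" by (auto simp: axis_eq_axis)
    then show ?thesis by (simp add: f_def)
  qed
  have Basis: "(Basis :: (real ^ 'd) set) = (\<lambda>i. axis i 1) ` UNIV" by (auto simp: Basis_vec_def)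
  have inj: "inj (\<lambda>i::'d. axis i (1::real))" by (auto simp: inj_def axis_eq_axis)
  let ?X = "{\<beta> \<in> unit_cube. \<forall>i. dist_int (y $ i - \<beta> $ i) \<le> a $ i \<and> dist_int (y' $ i - \<beta> $ i) \<le> b $ i}"
  have X: "?X = {\<beta>. \<forall>i. \<beta> $ i \<in> D i}" by (auto simp: D_def unit_cube_def)
  have "{\<beta>::real ^ 'd. \<forall>i. \<beta> $ i \<in> D i} \<in> sets borel" by measurable
  then have "emeasure lborel ?X = (\<integral>\<^sup>+\<beta>. indicator {\<beta>. \<forall>i. \<beta> $ i \<in> D i} \<beta> \<partial>lborel)"
    unfolding X by simp
  also have "\<dots> = (\<integral>\<^sup>+\<beta>. (\<Prod>e\<in>Basis. f e (\<beta> \<bullet> e)) \<partial>lborel)"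
  proof (rule nn_integral_cong)
    fix \<beta> :: "real ^ 'd"
    have "(\<Prod>e\<in>Basis. f e (\<beta> \<bullet> e)) = (\<Prod>i\<in>UNIV. indicator (D i) (\<beta> $ i))"
      unfolding Basis by (subst prod.reindex[OF inj]) (simp add: fax inner_axis)
    also have "\<dots> = indicator {\<beta>. \<forall>i. \<beta> $ i \<in> D i} \<beta>"
      by (auto simp: indicator_def prod_zero_iff)
    finally show "indicator {\<beta>. \<forall>i. \<beta> $ i \<in> D i} \<beta> = (\<Prod>e\<in>Basis. f e (\<beta> \<bullet> e))" by simp
  qed
  also have "\<dots> = (\<Prod>e\<in>Basis. \<integral>\<^sup>+t. f e t \<partial>lborel)"
    by (rule nn_integral_lborel_prod) (auto simp: Basis fax)
  also have "\<dots> = (\<Prod>i\<in>UNIV. emeasure lborel (D i))"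
    unfolding Basis by (subst prod.reindex[OF inj]) (simp add: fax)
  also have "\<dots> = (\<Prod>i\<in>UNIV. ennreal (arc_corr (a $ i) (b $ i) (y $ i - y' $ i)))"
    unfolding D_def using a b by (intro prod.cong measure_two_arcs(1)) auto
  also have "\<dots> = ennreal (\<Prod>i\<in>UNIV. arc_corr (a $ i) (b $ i) (y $ i - y' $ i))"
    using a b by (intro prod_ennreal measure_two_arcs(2)) auto
  finally show ?thesis .
qed

lemma unit_cube_borel [measurable]: "(unit_cube :: (real ^ 'd) set) \<in> sets borel"
  unfolding unit_cube_def by measurable

lemma emeasure_unit_cube: "emeasure lborel (unit_cube :: (real ^ 'd) set) = 1"
proof (rule antisym)
  have "emeasure lborel (unit_cube :: (real ^ 'd) set) \<le> emeasure lborel (cbox (0 :: real ^ 'd) 1)"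
    by (intro emeasure_mono) (auto simp: unit_cube_def mem_box_cart less_imp_le)
  also have "\<dots> = 1" by (subst emeasure_lborel_cbox_eq) (auto simp: Basis_vec_def inner_axis intro!: prod.neutral)
  finally show "emeasure lborel (unit_cube :: (real ^ 'd) set) \<le> 1" .
  have "1 = emeasure lborel (box (0 :: real ^ 'd) 1)"
    by (subst emeasure_lborel_box_eq) (auto simp: Basis_vec_def inner_axis intro!: prod.neutral)
  also have "\<dots> \<le> emeasure lborel (unit_cube :: (real ^ 'd) set)"
    by (intro emeasure_mono) (auto simp: unit_cube_def mem_box_cart less_imp_le)
  finally show "1 \<le> emeasure lborel (unit_cube :: (real ^ 'd) set)" .
qed

section \<open>Weakly correlated events\<close>

text \<open>
  A second Borel--Cantelli lemma for events whose correlations decay with the distance of their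
  indices.  Summing the bound on the covariances over one index produces the finite factor
  \<open>1 + 2 \<Sum>\<^sub>j w\<^sub>j\<close>, so the number of events that occur among the first \<open>N\<close> has variance at most a constant times its
  mean \<open>\<Psi> N\<close>.  By Chebyshev's inequality it stays below a fixed bound \<open>K\<close> for all \<open>N\<close> only with probability zero.
\<close>
lemma (in prob_space) AE_infinitely_often_of_weak_correlation:
  fixes E :: "nat \<Rightarrow> 'a set" and w :: "nat \<Rightarrow> real"
  assumes E: "\<And>n. E n \<in> events"
    and div: "\<not> summable (\<lambda>n. prob (E n))"
    and w: "summable w" "\<And>j. w j \<ge> 0"
    and corr: "\<And>n m. n \<noteq> m \<Longrightarrow> prob (E n \<inter> E m) - prob (E n) * prob (E m)
        \<le> w (nat \<bar>int n - int m\<bar>) * ((prob (E n) + prob (E m)) / 2)"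
  shows "AE x in M. infinite {n. x \<in> E n}"
proof -
  define p where "p = (\<lambda>n. prob (E n))"
  define \<Psi> where "\<Psi> = (\<lambda>N. \<Sum>n<N. p n)"
  define S where "S = (\<lambda>N x. \<Sum>n<N. indicator (E n) x :: real)"
  define v where "v = (\<lambda>n m. if n = m then 1 else w (nat \<bar>int n - int m\<bar>))"
  define W where "W = suminf w"
  define c where "c = 1 + 2 * W"
  have p: "0 \<le> p n" "p n \<le> 1" for n by (auto simp: p_def)
  have v: "v n m \<ge> 0" "v n m = v m n" for n m using w by (auto simp: v_def abs_minus_commute)
  have cov: "prob (E n \<inter> E m) - p n * p m \<le> v n m * ((p n + p m) / 2)" for n m
    using corr[of n m] p[of n] by (cases "n = m") (auto simp: v_def p_def)
  have W: "(\<Sum>j\<in>J. w j) \<le> W" if "finite J" for J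
    unfolding W_def using w that by (intro sum_le_suminf) auto
  have "W \<ge> 0" using W[of "{}"] by simp
  have row: "(\<Sum>m<N. v n m) \<le> c" for n N
  proof -
    have "(\<Sum>m<N. v n m) \<le> (\<Sum>m\<in>{n} \<union> {..<n} \<union> {n<..<n + N}. v n m)"
      using v by (intro sum_mono2) auto
    also have "\<dots> = v n n + (\<Sum>m<n. v n m) + (\<Sum>m\<in>{n<..<n + N}. v n m)"
      by (subst sum.union_disjoint; auto)+
    also have "(\<Sum>m<n. v n m) = (\<Sum>m<n. w (n - m))"
      by (intro sum.cong) (auto simp: v_def nat_diff_distrib' of_nat_diff)
    also have "\<dots> = (\<Sum>j\<in>(\<lambda>m. n - m) ` {..<n}. w j)" by (subst sum.reindex) (auto simp: inj_on_def)
    also have "\<dots> \<le> W" by (intro W) auto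
    also have "(\<Sum>m\<in>{n<..<n + N}. v n m) = (\<Sum>m\<in>{n<..<n + N}. w (m - n))"
      by (intro sum.cong) (auto simp: v_def nat_diff_distrib' of_nat_diff abs_if)
    also have "\<dots> = (\<Sum>j\<in>(\<lambda>m. m - n) ` {n<..<n + N}. w j)" by (subst sum.reindex) (auto simp: inj_on_def)
    also have "\<dots> \<le> W" by (intro W) auto
    finally show ?thesis by (simp add: v_def c_def)
  qed
  have ind: "integrable M (indicator A :: 'a \<Rightarrow> real)" if "A \<in> events" for A
    using that by (intro integrable_real_indicator) (auto simp: less_top[symmetric])
  have Sm [measurable]: "random_variable borel (S N)" for N unfolding S_def using E by measurable
  have ES: "expectation (S N) = \<Psi> N" for N
    unfolding S_def \<Psi>_def p_def using E by (simp add: Bochner_Integration.integral_sum ind)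
  have S2: "(S N x)\<^sup>2 = (\<Sum>n<N. \<Sum>m<N. indicator (E n \<inter> E m) x)" for N x
    by (simp add: S_def power2_eq_square sum_product indicator_inter_arith)
  have S2i: "integrable M (\<lambda>x. (S N x)\<^sup>2)" for N
    unfolding S2 using E by (intro Bochner_Integration.integrable_sum ind) auto
  have "variance (S N) \<le> c * \<Psi> N" for N
  proof -
    have "variance (S N) = expectation (\<lambda>x. (S N x)\<^sup>2) - (expectation (S N))\<^sup>2"
      using S2i E unfolding S_def by (intro variance_eq Bochner_Integration.integrable_sum ind) (auto simp: S_def)
    also have "\<dots> = (\<Sum>n<N. \<Sum>m<N. prob (E n \<inter> E m) - p n * p m)"
      unfolding S2 ES \<Psi>_def using E
      by (simp add: Bochner_Integration.integral_sum ind sum_subtractf power2_eq_square sum_product)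
    also have "\<dots> \<le> (\<Sum>n<N. \<Sum>m<N. v n m * ((p n + p m) / 2))" by (intro sum_mono cov)
    also have "\<dots> = (\<Sum>n<N. \<Sum>m<N. v n m * p n / 2) + (\<Sum>n<N. \<Sum>m<N. v n m * p m / 2)"
      by (simp add: sum.distrib add_divide_distrib distrib_left)
    also have "(\<Sum>n<N. \<Sum>m<N. v n m * p m / 2) = (\<Sum>n<N. \<Sum>m<N. v n m * p n / 2)"
      by (subst sum.swap) (simp add: v(2))
    also have "(\<Sum>n<N. \<Sum>m<N. v n m * p n / 2) + (\<Sum>n<N. \<Sum>m<N. v n m * p n / 2) = (\<Sum>n<N. (\<Sum>m<N. v n m) * p n)"
      by (simp add: sum_distrib_left mult.commute flip: sum.distrib)
    also have "\<dots> \<le> (\<Sum>n<N. c * p n)" using row p by (intro sum_mono mult_right_mono) auto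
    finally show ?thesis by (simp add: \<Psi>_def sum_distrib_left)
  qed
  note var = this
  have large: "\<exists>N. \<Psi> N \<ge> K" for K
  proof (rule ccontr)
    assume "\<not> ?thesis"
    then have "(\<Sum>n<N. p n) \<le> K" for N by (force simp: \<Psi>_def not_le intro: less_imp_le)
    then have "(\<Sum>n\<le>N. p n) \<le> K" for N by (simp only: lessThan_Suc_atMost[symmetric])
    then have "summable p" by (intro bounded_imp_summable[of p K] p)
    then show False using div by (simp add: p_def[abs_def])
  qed
  define B where "B = (\<lambda>K::nat. {x \<in> space M. \<forall>N. S N x \<le> real K})"
  have Bm [measurable]: "B K \<in> events" for K unfolding B_def by measurable
  have "prob (B K) \<le> e" if "e > 0" for K e
  proof -
    \<comment> \<open>A mean of at least \<open>2 K\<close> makes the deviation at least \<open>\<Psi> N / 2\<close>, so that Chebyshev gives \<open>4 c / \<Psi> N\<close>.\<close>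
    obtain N where N: "\<Psi> N \<ge> max (2 * real K + 1) (4 * c / e)" using large by blast
    then have pos: "\<Psi> N > 0" "\<Psi> N - K > 0" "\<Psi> N / 2 \<le> \<Psi> N - K" by auto
    have "prob (B K) \<le> prob {x \<in> space M. \<bar>S N x - expectation (S N)\<bar> \<ge> \<Psi> N - K}"
    proof (rule finite_measure_mono)
      show "B K \<subseteq> {x \<in> space M. \<bar>S N x - expectation (S N)\<bar> \<ge> \<Psi> N - K}"
      proof
        fix x assume "x \<in> B K"
        then have "x \<in> space M" "S N x \<le> real K" by (auto simp: B_def)
        then show "x \<in> {x \<in> space M. \<bar>S N x - expectation (S N)\<bar> \<ge> \<Psi> N - K}"
          unfolding ES by auto
      qed
    qed measurable
    also have "\<dots> \<le> variance (S N) / (\<Psi> N - K)\<^sup>2"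
      using S2i pos by (intro Chebyshev_inequality) auto
    also have "\<dots> \<le> c * \<Psi> N / (\<Psi> N / 2)\<^sup>2"
      using pos var[of N] \<open>W \<ge> 0\<close> by (intro frac_le power_mono) (auto simp: c_def)
    also have "\<dots> = 4 * c / \<Psi> N" using pos by (simp add: power2_eq_square field_simps)
    also have "\<dots> \<le> e" using N pos that by (simp add: field_simps)
    finally show ?thesis .
  qed
  then have "prob (B K) = 0" for K
    by (metis antisym field_le_epsilon add_0 measure_nonneg)
  then have "AE x in M. \<forall>K. x \<notin> B K"
    unfolding AE_all_countable
    by (intro allI AE_not_in) (auto simp: null_sets_def emeasure_eq_measure)
  then show ?thesis
  proof (rule AE_mp, intro AE_I2 impI notI)
    fix x assume x: "x \<in> space M" "\<forall>K. x \<notin> B K" "finite {n. x \<in> E n}"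
    have "S N x \<le> real (card {n. x \<in> E n})" for N
    proof -
      have "S N x = (\<Sum>n<N. of_bool (x \<in> E n))" by (simp add: S_def indicator_def of_bool_def)
      also have "\<dots> = real (card ({..<N} \<inter> {n. x \<in> E n}))" by (simp add: sum_of_bool_eq)
      also have "\<dots> \<le> real (card {n. x \<in> E n})" using x(3) by (intro of_nat_mono card_mono) auto
      finally show ?thesis .
    qed
    then have "x \<in> B (card {n. x \<in> E n})" using x(1) by (simp add: B_def)
    then show False using x(2) by blast
  qed
qed

section \<open>Decay of the Fourier transform along differences of the matrices\<close>

text \<open>Cauchy condensation reduces this to the convergence of \<open>\<Sum> n\<^bsup>-p\<^esup>\<close>.\<close>
lemma summable_inverse_log_plus:
  assumes "p > 1"
  shows "summable (\<lambda>n. 1 / (real n * log_plus (real n) powr p))"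
proof -
  have mono: "1 / (real (Suc m) * log_plus (real (Suc m)) powr p) \<le> 1 / (real m * log_plus (real m) powr p)"
    if "0 < m" for m
  proof -
    have "log_plus (real m) \<le> log_plus (real (Suc m))"
      unfolding log_plus_def using that by (intro max.mono) auto
    moreover have "log_plus x \<ge> 1" for x by (simp add: log_plus_def)
    then have "log_plus x > 0" for x by (rule less_le_trans[OF zero_less_one])
    ultimately show ?thesis
      using that assms
      by (intro divide_left_mono mult_mono powr_mono2 mult_pos_pos) (auto simp: less_imp_le less_imp_neq[symmetric])
  qed
  have "summable (\<lambda>n. real n powr (- p))"
    using assms by (simp add: summable_real_powr_iff)
  then have "summable (\<lambda>n. ln 2 powr (- p) * real n powr (- p))" by (rule summable_mult)
  then have "summable (\<lambda>n. 2 ^ n * (1 / (real (2 ^ n) * log_plus (real (2 ^ n)) powr p)))"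
  proof (rule summable_comparison_test_ev[rotated])
    show "eventually (\<lambda>n. norm (2 ^ n * (1 / (real (2 ^ n) * log_plus (real (2 ^ n)) powr p)))
        \<le> ln 2 powr (- p) * real n powr (- p)) sequentially"
      using eventually_gt_at_top[of 0]
    proof eventually_elim
      case (elim n)
      have "log_plus (real (2 ^ n)) powr p \<ge> (ln 2 * real n) powr p"
        using assms by (intro powr_mono2) (auto simp: log_plus_def ln_realpow mult.commute)
      moreover have "(ln 2 * real n) powr p > 0" using elim by simp
      ultimately have "1 / log_plus (real (2 ^ n)) powr p \<le> 1 / (ln 2 * real n) powr p"
        by (intro divide_left_mono mult_pos_pos) auto
      also have "\<dots> = ln 2 powr (- p) * real n powr (- p)"
        by (simp add: powr_mult powr_minus_divide)
      finally show ?case by simp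
    qed
  qed
  then show ?thesis
    by (subst condensation_test) (use mono in auto)
qed

text \<open>
  The transpose has the same smallest singular value.  If \<open>\<sigma> > 0\<close> then \<open>B\<close> is bijective; writing \<open>x = B y\<close>
  with \<open>norm y \<le> norm x / \<sigma>\<close>, the claim is the Cauchy--Schwarz inequality for
  \<open>x \<bullet> x = (x v* B) \<bullet> y\<close>.
\<close>
lemma smallest_singular_value_transpose:
  fixes B :: "real ^ 'd ^ 'd"
  shows "smallest_singular_value B * norm x \<le> norm (x v* B)"
proof (cases "smallest_singular_value B \<le> 0")
  case True
  then show ?thesis by (meson mult_nonpos_nonneg norm_ge_zero order_trans)
next
  case False
  define \<sigma> where "\<sigma> = smallest_singular_value B"
  have \<sigma>: "\<sigma> > 0" using False by (simp add: \<sigma>_def)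
  have lower: "\<sigma> * norm y \<le> norm (B *v y)" for y
  proof (cases "y = 0")
    case False
    have "\<sigma> \<le> norm (B *v ((1 / norm y) *\<^sub>R y))"
      unfolding \<sigma>_def smallest_singular_value_def using False
      by (intro cInf_lower bdd_belowI[of _ 0]) auto
    also have "\<dots> = norm (B *v y) / norm y" by (simp add: matrix_vector_mult_scaleR)
    finally show ?thesis using False by (simp add: field_simps)
  qed simp
  have "inj ((*v) B)"
  proof (rule injI)
    fix u v assume "B *v u = B *v v"
    then have "norm (B *v (u - v)) = 0" by (simp add: matrix_vector_mult_diff_distrib)
    then show "u = v" using lower[of "u - v"] \<sigma> by (simp add: mult_le_0_iff)
  qed
  then have "surj ((*v) B)"
    by (intro linear_injective_imp_surjective) auto
  then obtain y where y: "B *v y = x" by (metis surjD)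
  have "norm x * (\<sigma> * norm y) \<le> norm x * norm x"
    using lower[of y] y by (intro mult_left_mono) auto
  also have "\<dots> = x \<bullet> (B *v y)" by (simp add: y power2_norm_eq_inner flip: power2_eq_square)
  also have "\<dots> = (x v* B) \<bullet> y" by (rule dot_lmul_matrix[symmetric])
  also have "\<dots> \<le> norm (x v* B) * norm y" by (rule norm_cauchy_schwarz)
  finally have "(\<sigma> * norm x) * norm y \<le> norm (x v* B) * norm y" by (simp add: mult_ac)
  then show ?thesis
    using y by (cases "y = 0") (auto simp: \<sigma>_def)
qed

text \<open>
  Below the threshold \<open>T\<close> from which the asymptotic bound holds, the transform is at most \<open>1\<close>,
  and \<open>1 \<le> (max T 1 / infnorm t)\<^bsup>s\<^esup>\<close>.
\<close>
lemma fourier_transform_power_decay: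
  fixes \<mu> :: "(real ^ 'd) measure"
  assumes "prob_space \<mu>" and "s > 0"
    and decay: "(\<lambda>t. norm (fourier_transform \<mu> t))
      \<in> O[filtercomap infnorm at_top](\<lambda>t. infnorm t powr (- s))"
  obtains K where "K > 0" "\<And>t. t \<noteq> 0 \<Longrightarrow> norm (fourier_transform \<mu> t) \<le> K * infnorm t powr (- s)"
proof -
  interpret prob_space \<mu> by fact
  obtain K where "K > 0" and K: "eventually (\<lambda>t. norm (norm (fourier_transform \<mu> t)) \<le> K * norm (infnorm t powr (- s)))
      (filtercomap infnorm at_top)"
    using landau_o.bigE[OF decay] by blast
  from K obtain T where T: "\<And>t. infnorm t \<ge> T \<Longrightarrow> norm (norm (fourier_transform \<mu> t)) \<le> K * norm (infnorm t powr (- s))"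
    unfolding eventually_filtercomap_at_top_linorder by blast
  define K' where "K' = max K (max T 1 powr s)"
  show ?thesis
  proof (rule that[of K'])
    show "K' > 0" using \<open>K > 0\<close> by (simp add: K'_def)
    fix t :: "real ^ 'd" assume "t \<noteq> 0"
    then have pos: "infnorm t > 0" by (simp add: infnorm_pos_lt)
    show "norm (fourier_transform \<mu> t) \<le> K' * infnorm t powr (- s)"
    proof (cases "infnorm t \<ge> T")
      case True
      have "norm (fourier_transform \<mu> t) \<le> K * infnorm t powr (- s)" using T[OF True] by simp
      also have "\<dots> \<le> K' * infnorm t powr (- s)" by (intro mult_right_mono) (auto simp: K'_def)
      finally show ?thesis .
    next
      case False
      have "norm (fourier_transform \<mu> t) \<le> (\<integral>x. norm (exp (- 2 * complex_of_real pi * \<i> * complex_of_real (t \<bullet> x))) \<partial>\<mu>)"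
        unfolding fourier_transform_def by (rule integral_norm_bound)
      also have "\<dots> = 1" by (simp add: norm_exp_eq_Re prob_space)
      also have "1 = infnorm t powr s * infnorm t powr (- s)" using pos by (simp add: powr_minus)
      also have "\<dots> \<le> max T 1 powr s * infnorm t powr (- s)"
        using False pos \<open>s > 0\<close> by (intro mult_right_mono powr_mono2) auto
      also have "\<dots> \<le> K' * infnorm t powr (- s)" by (intro mult_right_mono) (auto simp: K'_def)
      finally show ?thesis .
    qed
  qed
qed

lemma integer_vector_norm_ge_1:
  fixes k :: "real ^ 'd"
  assumes "k \<noteq> 0" "\<forall>i. k $ i \<in> \<int>"
  shows "norm k \<ge> 1"
proof -
  obtain i where "k $ i \<noteq> 0" using assms(1) by (auto simp: vec_eq_iff)
  then have "\<bar>k $ i\<bar> \<ge> 1" using assms(2) Ints_nonzero_abs_ge1 by blast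
  then show ?thesis using component_le_norm_cart[of k i] by linarith
qed

text \<open>
  The exponents in the gap hypothesis are chosen so that raising it to the power \<open>-s\<close> gives
  \<open>1 / (j log\<^sub>+(j)\<^bsup>1 + s\<epsilon>\<^esup>)\<close>.  The constant \<open>D\<close> below compares the Euclidean norm with the maximum norm.
\<close>
lemma fourier_transform_gap_bound:
  fixes \<mu> :: "(real ^ 'd) measure" and A :: "nat \<Rightarrow> real ^ 'd ^ 'd"
  assumes "prob_space \<mu>" and "c > 0" "s > 0" "\<epsilon> > 0"
    and gap: "\<And>m n. m \<ge> 1 \<Longrightarrow> n \<ge> 1 \<Longrightarrow> m \<noteq> n \<Longrightarrow>
      smallest_singular_value (A n - A m)
        \<ge> c * \<bar>real n - real m\<bar> powr (1 / s) * log_plus \<bar>real n - real m\<bar> powr (1 / s + \<epsilon>)"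
    and decay: "(\<lambda>t. norm (fourier_transform \<mu> t))
      \<in> O[filtercomap infnorm at_top](\<lambda>t. infnorm t powr (- s))"
  obtains w where "summable w" "\<And>j. w j \<ge> 0"
    "\<And>m n k. m \<ge> 1 \<Longrightarrow> n \<ge> 1 \<Longrightarrow> m \<noteq> n \<Longrightarrow> k \<noteq> 0 \<Longrightarrow> (\<forall>i. k $ i \<in> \<int>) \<Longrightarrow>
      norm (fourier_transform \<mu> (- (k v* (A n - A m)))) \<le> w (nat \<bar>int n - int m\<bar>)"
proof -
  obtain K where K: "K > 0" "\<And>t. t \<noteq> 0 \<Longrightarrow> norm (fourier_transform \<mu> t) \<le> K * infnorm t powr (- s)"
    using fourier_transform_power_decay[OF assms(1,3) decay] by blast
  define D where "D = sqrt (real DIM(real ^ 'd))"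
  have D: "D > 0" by (simp add: D_def)
  define K' where "K' = K * (c / D) powr (- s)"
  define w where "w = (\<lambda>j. K' * (1 / (real j * log_plus (real j) powr (1 + s * \<epsilon>))))"
  have lp: "log_plus x > 0" for x by (simp add: log_plus_def less_max_iff_disj)
  show ?thesis
  proof (rule that[of w])
    show "summable w" unfolding w_def
      using \<open>s > 0\<close> \<open>\<epsilon> > 0\<close> by (intro summable_mult summable_inverse_log_plus) simp
    show "w j \<ge> 0" for j using K(1) by (simp add: w_def K'_def)
    fix m n :: nat and k :: "real ^ 'd"
    assume mn: "m \<ge> 1" "n \<ge> 1" "m \<noteq> n" and k: "k \<noteq> 0" "\<forall>i. k $ i \<in> \<int>"
    define j where "j = nat \<bar>int n - int m\<bar>"
    have j: "\<bar>real n - real m\<bar> = real j" "j > 0" using mn by (auto simp: j_def)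
    define t where "t = - (k v* (A n - A m))"
    define \<sigma> where "\<sigma> = c * real j powr (1 / s) * log_plus (real j) powr (1 / s + \<epsilon>)"
    have \<sigma>: "\<sigma> > 0" using j \<open>c > 0\<close> lp[of "real j"] by (simp add: \<sigma>_def)
    have "\<sigma> \<le> smallest_singular_value (A n - A m)" using gap[OF mn] j by (simp add: \<sigma>_def)
    also have "\<dots> \<le> smallest_singular_value (A n - A m) * norm k"
      using integer_vector_norm_ge_1[OF k] \<sigma> calculation by (simp add: mult_le_cancel_left1)
    also have "\<dots> \<le> norm t" unfolding t_def norm_minus_cancel by (rule smallest_singular_value_transpose)
    also have "\<dots> \<le> D * infnorm t" unfolding D_def by (rule norm_le_infnorm)
    finally have "\<sigma> / D \<le> infnorm t" using D by (simp add: field_simps)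
    moreover from this have "t \<noteq> 0" using \<sigma> D by (auto simp: infnorm_0 divide_le_0_iff)
    ultimately have "norm (fourier_transform \<mu> t) \<le> K * (\<sigma> / D) powr (- s)"
      using K \<sigma> D \<open>s > 0\<close>
      by (intro order_trans[OF K(2)] mult_left_mono powr_mono2') auto
    also have "\<sigma> / D = (c / D) * (real j powr (1 / s) * log_plus (real j) powr (1 / s + \<epsilon>))"
      by (simp add: \<sigma>_def)
    also have "K * \<dots> powr (- s) = K' * (real j powr (1 / s * - s) * log_plus (real j) powr ((1 / s + \<epsilon>) * - s))"
    proof -
      have split: "(x * (y * z)) powr t = x powr t * (y powr t * z powr t)" if "x \<ge> 0" "y \<ge> 0" "z \<ge> 0" for x y z t :: real
        using that by (simp add: powr_mult)
      have "(c / D * (real j powr (1 / s) * log_plus (real j) powr (1 / s + \<epsilon>))) powr (- s) =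
          (c / D) powr (- s) * ((real j powr (1 / s)) powr (- s) * (log_plus (real j) powr (1 / s + \<epsilon>)) powr (- s))"
        by (rule split) (use \<open>c > 0\<close> D in auto)
      then show ?thesis by (simp only: K'_def powr_powr mult.assoc)
    qed
    also have "1 / s * - s = - 1" using \<open>s > 0\<close> by simp
    also have "(1 / s + \<epsilon>) * - s = - (1 + s * \<epsilon>)" using \<open>s > 0\<close> by (simp add: field_simps)
    also have "K' * (real j powr - 1 * log_plus (real j) powr (- (1 + s * \<epsilon>))) = w j"
      unfolding powr_minus using j(2) by (simp add: w_def inverse_eq_divide)
    finally show "norm (fourier_transform \<mu> (- (k v* (A n - A m)))) \<le> w (nat \<bar>int n - int m\<bar>)"
      by (simp only: t_def j_def)
  qed
qed

section \<open>The dichotomy\<close>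

theorem theorem4:
  fixes r :: "nat \<Rightarrow> real ^ 'd"
    and \<mu> :: "(real ^ 'd) measure"
    and A :: "nat \<Rightarrow> real ^ 'd ^ 'd"
    and c s \<epsilon> :: real
  assumes "doubling r"
    and "prob_space \<mu>"
    and "sets \<mu> = sets (restrict_space borel unit_cube)"
    and "\<And>n i j. n \<ge> 1 \<Longrightarrow> A n $ i $ j \<in> \<int>"
    and "c > 0" and "s > 0" and "\<epsilon> > 0"
    and "\<And>m n. m \<ge> 1 \<Longrightarrow> n \<ge> 1 \<Longrightarrow> m \<noteq> n \<Longrightarrow>
      smallest_singular_value (A n - A m)
        \<ge> c * \<bar>real n - real m\<bar> powr (1 / s) * log_plus \<bar>real n - real m\<bar> powr (1 / s + \<epsilon>)"
    and "(\<lambda>t. norm (fourier_transform \<mu> t))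
      \<in> O[filtercomap infnorm at_top](\<lambda>t. infnorm t powr (- s))"
  shows "AE \<alpha> in \<mu>.
    (summable (\<lambda>n. \<Prod>i\<in>UNIV. r (Suc n) $ i) \<longrightarrow> emeasure lebesgue (target_set \<alpha> A r) = 0) \<and>
    (\<not> summable (\<lambda>n. \<Prod>i\<in>UNIV. r (Suc n) $ i) \<longrightarrow> emeasure lebesgue (target_set \<alpha> A r) = 1)"
proof -
  interpret \<mu>: prob_space \<mu> by fact
  define \<nu> :: "(real ^ 'd) measure" where "\<nu> = restrict_space lborel unit_cube"
  have space\<nu>: "space \<nu> = unit_cube" by (simp add: \<nu>_def space_restrict_space)
  have e\<nu>: "emeasure \<nu> X = emeasure lborel X" if "X \<subseteq> unit_cube" for X
    using that by (simp add: \<nu>_def emeasure_restrict_space)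
  interpret \<nu>: prob_space \<nu>
    by (rule prob_spaceI) (simp add: space\<nu> e\<nu> emeasure_unit_cube)
  interpret P: pair_prob_space \<mu> \<nu> ..
  have r: "0 < r n $ i \<and> r n $ i < 1 / 2" if "n \<ge> 1" for n i
    using assms(1) that by (auto simp: doubling_def)
  define p where "p = (\<lambda>n. \<Prod>i\<in>UNIV. 2 * r n $ i)"
  have p0: "p n \<ge> 0" if "n \<ge> 1" for n
    unfolding p_def using r[OF that] by (intro prod_nonneg) (auto simp: less_imp_le)
  have summable_iff: "summable (\<lambda>n. \<Prod>i\<in>UNIV. r (Suc n) $ i) \<longleftrightarrow> summable (\<lambda>n. p (Suc n))"
    unfolding p_def prod.distrib by (simp add: summable_cmult_iff)
  define hit where "hit = (\<lambda>n \<alpha> \<beta>. \<forall>i. dist_int ((A n *v \<alpha>) $ i - \<beta> $ i) \<le> r n $ i)"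
  define H where "H = (\<lambda>n \<alpha>. {\<beta> \<in> unit_cube. hit n \<alpha> \<beta>})"
  have mv [measurable]: "(\<lambda>z. (B *v fst z) $ i) \<in> borel_measurable (\<mu> \<Otimes>\<^sub>M \<nu>)" for B :: "real ^ 'd ^ 'd" and i
  proof -
    have "(\<lambda>x. (B *v x) $ i) \<in> borel_measurable \<mu>"
      using measurable_restrict_space1[OF matrix_vector_mult_nth_measurable] measurable_cong_sets[OF assms(3) refl] by blast
    then show ?thesis by measurable
  qed
  have coord: "(\<lambda>x. x $ i) \<in> borel_measurable \<nu>" for i
    unfolding \<nu>_def by (rule measurable_restrict_space1) simp
  have bv [measurable]: "(\<lambda>z. snd z $ i) \<in> borel_measurable (\<mu> \<Otimes>\<^sub>M \<nu>)" for i
    by (rule measurable_compose[OF measurable_snd coord])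
  define E where "E = (\<lambda>n. {z \<in> space (\<mu> \<Otimes>\<^sub>M \<nu>). hit n (fst z) (snd z)})"
  have E [measurable]: "E n \<in> sets (\<mu> \<Otimes>\<^sub>M \<nu>)" for n
    unfolding E_def hit_def by measurable
  have H: "H n \<alpha> \<in> sets borel" for n \<alpha>
  proof -
    have "{\<beta>. hit n \<alpha> \<beta>} \<in> sets borel" unfolding hit_def by measurable
    moreover have "H n \<alpha> = unit_cube \<inter> {\<beta>. hit n \<alpha> \<beta>}" by (auto simp: H_def)
    ultimately show ?thesis by simp
  qed
  have H\<nu>: "H n \<alpha> \<in> sets \<nu>" for n \<alpha>
    using H[of n \<alpha>] by (auto simp: \<nu>_def sets_restrict_space_iff H_def)
  \<comment> \<open>The volume of the overlap of the boxes with indices \<open>n\<close> and \<open>m\<close> around \<open>A\<^sub>n \<alpha>\<close> and \<open>A\<^sub>m \<alpha>\<close> on the torus.\<close>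
  define q where "q = (\<lambda>n m \<alpha>. \<Prod>i\<in>UNIV. arc_corr (r n $ i) (r m $ i) (((A n - A m) *v \<alpha>) $ i))"
  have HH: "emeasure \<nu> (H n \<alpha> \<inter> H m \<alpha>) = ennreal (q n m \<alpha>)" if "n \<ge> 1" "m \<ge> 1" for n m \<alpha>
  proof -
    have "H n \<alpha> \<inter> H m \<alpha> = {\<beta> \<in> unit_cube. \<forall>i. dist_int ((A n *v \<alpha>) $ i - \<beta> $ i) \<le> r n $ i \<and> dist_int ((A m *v \<alpha>) $ i - \<beta> $ i) \<le> r m $ i}"
      by (auto simp: H_def hit_def)
    then show ?thesis
      using measure_box_overlap[of "r n" "r m" "A n *v \<alpha>" "A m *v \<alpha>"] r[OF that(1)] r[OF that(2)] e\<nu>[of "H n \<alpha> \<inter> H m \<alpha>"]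
      by (auto simp: q_def H_def matrix_vector_mult_diff_rdistrib)
  qed
  have q0: "q n m \<alpha> \<ge> 0" if "n \<ge> 1" "m \<ge> 1" for n m \<alpha>
  proof -
    have "arc_corr (r n $ i) (r m $ i) (((A n - A m) *v \<alpha>) $ i) \<ge> 0" for i
      using measure_two_arcs(2)[of "r n $ i" "r m $ i" "((A n - A m) *v \<alpha>) $ i" 0] r[OF that(1), of i] r[OF that(2), of i] by simp
    then show ?thesis unfolding q_def by (intro prod_nonneg) auto
  qed
  have diag: "q n n \<alpha> = p n" if "n \<ge> 1" for n \<alpha>
    using r[OF that] by (simp add: q_def p_def arc_corr_diag)
  have H1: "emeasure \<nu> (H n \<alpha>) = ennreal (p n)" if "n \<ge> 1" for n \<alpha>
    using HH[OF that that, of \<alpha>] diag[OF that] by simp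
  \<comment> \<open>Fubini: the section of \<open>E n \<inter> E m\<close> over \<open>\<alpha>\<close> is the intersection of two boxes.\<close>
  have EE: "measure (\<mu> \<Otimes>\<^sub>M \<nu>) (E n \<inter> E m) = (\<integral>\<alpha>. q n m \<alpha> \<partial>\<mu>)" if "n \<ge> 1" "m \<ge> 1" for n m
  proof -
    have "emeasure (\<mu> \<Otimes>\<^sub>M \<nu>) (E n \<inter> E m) = (\<integral>\<^sup>+\<alpha>. emeasure \<nu> (Pair \<alpha> -` (E n \<inter> E m)) \<partial>\<mu>)"
      by (rule \<nu>.emeasure_pair_measure_alt) measurable
    also have "\<dots> = (\<integral>\<^sup>+\<alpha>. ennreal (q n m \<alpha>) \<partial>\<mu>)"
    proof (rule nn_integral_cong)
      fix \<alpha> assume "\<alpha> \<in> space \<mu>"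
      then have "Pair \<alpha> -` (E n \<inter> E m) = H n \<alpha> \<inter> H m \<alpha>"
        by (auto simp: E_def H_def space_pair_measure space\<nu>)
      then show "emeasure \<nu> (Pair \<alpha> -` (E n \<inter> E m)) = ennreal (q n m \<alpha>)" using HH[OF that] by simp
    qed
    also have "\<dots> = ennreal (\<integral>\<alpha>. q n m \<alpha> \<partial>\<mu>)"
    proof (rule nn_integral_eq_integral)
      have "q n m \<in> borel_measurable borel" unfolding q_def by measurable
      then have "q n m \<in> borel_measurable \<mu>"
        using measurable_restrict_space1 measurable_cong_sets[OF assms(3) refl] by blast
      moreover have "q n m \<alpha> \<le> 1" for \<alpha>
        using \<nu>.emeasure_le_1[of "H n \<alpha> \<inter> H m \<alpha>"] HH[OF that] q0[OF that] by simp
      ultimately show "integrable \<mu> (q n m)"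
        using q0[OF that] by (intro \<mu>.integrable_const_bound[where B = 1]) auto
    qed (use q0[OF that] in auto)
    finally show ?thesis using q0[OF that] by (simp add: measure_def)
  qed
  have E1: "measure (\<mu> \<Otimes>\<^sub>M \<nu>) (E n) = p n" if "n \<ge> 1" for n
    using EE[OF that that] diag[OF that] by (simp add: \<mu>.prob_space)
  have target: "target_set \<alpha> A r = {\<beta> \<in> unit_cube. infinite {n. hit (Suc n) \<alpha> \<beta>}}" for \<alpha>
  proof -
    have "infinite {n. n \<ge> 1 \<and> hit n \<alpha> \<beta>} \<longleftrightarrow> infinite {n. hit (Suc n) \<alpha> \<beta>}" for \<beta>
    proof -
      have "{n. n \<ge> 1 \<and> hit n \<alpha> \<beta>} = Suc ` {n. hit (Suc n) \<alpha> \<beta>}"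
        by (auto simp: image_iff) (metis Suc_le_D One_nat_def)
      then show ?thesis by (simp add: finite_image_iff)
    qed
    then show ?thesis by (simp add: target_set_def ex_target_box_cong_iff hit_def)
  qed
  have Tm: "target_set \<alpha> A r \<in> sets borel" for \<alpha>
  proof -
    have "target_set \<alpha> A r = {\<beta>. \<exists>\<^sub>\<infinity>n. \<beta> \<in> H (Suc n) \<alpha>}"
      by (auto simp: target H_def INFM_iff_infinite)
    also have "\<dots> \<in> sets borel" unfolding INFM_nat using H by measurable
    finally show ?thesis .
  qed
  have leb: "emeasure lebesgue (target_set \<alpha> A r) = emeasure \<nu> (target_set \<alpha> A r)" for \<alpha>
    using Tm by (subst e\<nu>) (auto simp: target)
  have T\<nu>: "target_set \<alpha> A r \<in> sets \<nu>" for \<alpha>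
    using Tm[of \<alpha>] by (auto simp: \<nu>_def sets_restrict_space_iff target)
  have conv: "emeasure lebesgue (target_set \<alpha> A r) = 0" if sm: "summable (\<lambda>n. p (Suc n))" for \<alpha>
  proof -
    have "AE \<beta> in \<nu>. eventually (\<lambda>n. \<beta> \<in> space \<nu> - H (Suc n) \<alpha>) sequentially"
    proof (rule borel_cantelli_AE1)
      show "summable (\<lambda>n. measure \<nu> (H (Suc n) \<alpha>))"
        using sm H1 p0 by (simp add: measure_def)
    qed (use H\<nu> in \<open>auto simp: \<nu>.emeasure_finite less_top[symmetric]\<close>)
    then have "AE \<beta> in \<nu>. \<beta> \<notin> target_set \<alpha> A r"
    proof eventually_elim
      case (elim \<beta>)
      then obtain N where "\<And>n. n \<ge> N \<Longrightarrow> \<not> hit (Suc n) \<alpha> \<beta>"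
        by (auto simp: eventually_sequentially H_def space\<nu>)
      then have "{n. hit (Suc n) \<alpha> \<beta>} \<subseteq> {..<N}" by (auto simp: not_less[symmetric])
      then show ?case using finite_subset by (auto simp: target)
    qed
    then show ?thesis using T\<nu> unfolding leb by (simp add: AE_iff_null_sets null_setsD1)
  qed
  have div: "AE \<alpha> in \<mu>. emeasure lebesgue (target_set \<alpha> A r) = 1" if ns: "\<not> summable (\<lambda>n. p (Suc n))"
  proof -
    obtain w where w: "summable w" "\<And>j. w j \<ge> 0"
      "\<And>m n k. m \<ge> 1 \<Longrightarrow> n \<ge> 1 \<Longrightarrow> m \<noteq> n \<Longrightarrow> k \<noteq> 0 \<Longrightarrow> (\<forall>i. k $ i \<in> \<int>) \<Longrightarrow>
        norm (fourier_transform \<mu> (- (k v* (A n - A m)))) \<le> w (nat \<bar>int n - int m\<bar>)"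
      using fourier_transform_gap_bound[OF assms(2,5-9)] by blast
    have "AE z in \<mu> \<Otimes>\<^sub>M \<nu>. infinite {n. z \<in> E (Suc n)}"
    proof (rule P.AE_infinitely_often_of_weak_correlation[OF _ _ w(1,2)])
      show "E (Suc n) \<in> P.events" for n by measurable
      show "\<not> summable (\<lambda>n. P.prob (E (Suc n)))" using ns E1 by simp
      fix n m :: nat assume nm: "n \<noteq> m"
      have "\<bar>(\<integral>\<alpha>. q (Suc n) (Suc m) \<alpha> \<partial>\<mu>) - p (Suc n) * p (Suc m)\<bar> \<le> w (nat \<bar>int n - int m\<bar>) * ((p (Suc n) + p (Suc m)) / 2)"
        unfolding q_def p_def using nm r w(3)[of "Suc m" "Suc n"] w(2)
        by (intro integral_box_corr[OF assms(2,3)]) auto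
      then show "P.prob (E (Suc n) \<inter> E (Suc m)) - P.prob (E (Suc n)) * P.prob (E (Suc m))
          \<le> w (nat \<bar>int n - int m\<bar>) * ((P.prob (E (Suc n)) + P.prob (E (Suc m))) / 2)"
        by (simp only: EE E1 le_add1 One_nat_def Suc_le_mono le0)
    qed
    from P.AE_pair[OF this] show ?thesis
    proof (rule AE_mp, intro AE_I2 impI)
      fix \<alpha> assume \<alpha>: "\<alpha> \<in> space \<mu>" and ae: "AE \<beta> in \<nu>. infinite {n. (\<alpha>, \<beta>) \<in> E (Suc n)}"
      have "AE \<beta> in \<nu>. \<beta> \<in> target_set \<alpha> A r"
        using ae AE_space by eventually_elim (use \<alpha> in \<open>auto simp: E_def target space_pair_measure space\<nu>\<close>)
      then show "emeasure lebesgue (target_set \<alpha> A r) = 1"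
        unfolding leb using T\<nu> by (simp add: \<nu>.emeasure_eq_1_AE)
    qed
  qed
  show ?thesis
  proof (cases "summable (\<lambda>n. p (Suc n))")
    case True
    then show ?thesis using conv by (simp add: summable_iff)
  next
    case False
    with div have "AE \<alpha> in \<mu>. emeasure lebesgue (target_set \<alpha> A r) = 1" by blast
    with False show ?thesis by (simp add: summable_iff)
  qed
qed

end
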